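(* Let $k$ be a field, let $R=k[\![x,y]\!]/((x^3-y^7)x)$, and let $P_1=(x^3-y^7)/((x^3-y^7)x)$ and $P_2=(x)/((x^3-y^7)x)$ be the minimal prime ideals of $R$. Let $R_{\text{art}}=(A\hookrightarrow B)$ be the Artinian pair associated to $R$, where $B=B_1\times B_2=k[\![t]\!]/(t^{19})\times k[\![y]\!]/(y^7)$. If $n\ge 4$, then there do not exist indecomposable $R_{\text{art}}$-modules $V\hookrightarrow W$ with $W=B_1\times B_2^{(n)}$.
   Context: An Artinian pair $A\hookrightarrow B$ is a module-finite extension of commutative Artinian rings. A module over $A\hookrightarrow B$ is a pair $V\hookrightarrow W$ where $W$ is a finitely generated projective $B$-module, $V$ is an $A$-submodule of $W$, and $BV=W$. A homomorphism from $V_1\hookrightarrow W_1$ to $V_2\hookrightarrow W_2$ is a $B$-module homomorphism $\varphi\colon W_1\to W_2$ with $\varphi(V_1)\subseteq V_2$; isomorphism, direct sums and indecomposability are defined accordingly. For a one-dimensional analytically unramified local ring $R$ (i.e. one whose completion is reduced) with integral closure $\overline R\neq R$ in its total quotient ring, the conductor is $\mathfrak c=\{r\in R\mid r\overline R\subseteq R\}$, and the Artinian pair associated to $R$ is $R_{\text{art}}=(R/\mathfrak c\hookrightarrow\overline R/\mathfrak c)$, so $A=R/\mathfrak c$ and $B=\overline R/\mathfrak c$. For $R=k[\![x,y]\!]/((x^3-y^7)x)$, the integral closure is $\overline R=k[\![t]\!]\times k[\![y]\!]$ (first factor the integral closure of $R/P_1$, second factor $R/P_2$), with the embedding $R\hookrightarrow\overline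 R$ given by $\bar x\mapsto(t^7,0)$, $\bar y\mapsto(t^3,y)$; the conductor, as an ideal of $\overline R$, is $(t^{19})\times(y^7)$. $B_2^{(n)}$ denotes the free $B_2$-module of rank $n$; $B_1\times B_2^{(n)}$ is a $B$-module componentwise. *)

theory Defs
  imports
    "HOL-Algebra.Algebraic_Closure_Type"
    "HOL-Algebra.Chinese_Remainder"
    "HOL-Algebra.Module"
    "HOL-Computational_Algebra.Formal_Laurent_Series"
begin

section \<open>Modules\<close>

text \<open>The ring fields \<open>mult\<close> and \<open>one\<close> of a module record carry no meaning, so they are left
  unspecified below.\<close>

definition regular_module :: "('a, 'm) ring_scheme \<Rightarrow> ('a, 'a) module" where
  "regular_module R =
     \<lparr>carrier = carrier R, monoid.mult = undefined, one = undefined,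
      ring.zero = \<zero>\<^bsub>R\<^esub>, add = add R, module.smult = monoid.mult R\<rparr>"

definition free_module :: "('a, 'm) ring_scheme \<Rightarrow> 'i set \<Rightarrow> ('a, 'i \<Rightarrow> 'a) module" where
  "free_module R I =
     \<lparr>carrier = {f \<in> I \<rightarrow>\<^sub>E carrier R. finite {i \<in> I. f i \<noteq> \<zero>\<^bsub>R\<^esub>}},
      monoid.mult = undefined, one = undefined,
      ring.zero = (\<lambda>i\<in>I. \<zero>\<^bsub>R\<^esub>),
      add = (\<lambda>f g. \<lambda>i\<in>I. f i \<oplus>\<^bsub>R\<^esub> g i),
      module.smult = (\<lambda>r f. \<lambda>i\<in>I. r \<otimes>\<^bsub>R\<^esub> f i)\<rparr>"

definition direct_sum ::
  "('a, 'v) module \<Rightarrow> ('a, 'w) module \<Rightarrow> ('a, 'v \<times> 'w) module" where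
  "direct_sum M N =
     \<lparr>carrier = carrier M \<times> carrier N, monoid.mult = undefined, one = undefined,
      ring.zero = (\<zero>\<^bsub>M\<^esub>, \<zero>\<^bsub>N\<^esub>),
      add = (\<lambda>(v, w) (v', w'). (v \<oplus>\<^bsub>M\<^esub> v', w \<oplus>\<^bsub>N\<^esub> w')),
      module.smult = (\<lambda>r (v, w). (r \<odot>\<^bsub>M\<^esub> v, r \<odot>\<^bsub>N\<^esub> w))\<rparr>"

definition restrict_scalars :: "('b \<Rightarrow> 'a) \<Rightarrow> ('a, 'w) module \<Rightarrow> ('b, 'w) module" where
  "restrict_scalars h M =
     \<lparr>carrier = carrier M, monoid.mult = undefined, one = undefined,
      ring.zero = \<zero>\<^bsub>M\<^esub>, add = add M, module.smult = (\<lambda>r. module.smult M (h r))\<rparr>"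

definition module_hom ::
  "('a, 'm) ring_scheme \<Rightarrow> ('a, 'v) module \<Rightarrow> ('a, 'w) module \<Rightarrow> ('v \<Rightarrow> 'w) set" where
  "module_hom R M N =
     {f \<in> carrier M \<rightarrow> carrier N.
        (\<forall>x\<in>carrier M. \<forall>y\<in>carrier M. f (x \<oplus>\<^bsub>M\<^esub> y) = f x \<oplus>\<^bsub>N\<^esub> f y) \<and>
        (\<forall>r\<in>carrier R. \<forall>x\<in>carrier M. f (r \<odot>\<^bsub>M\<^esub> x) = r \<odot>\<^bsub>N\<^esub> f x)}"

text \<open>The submodule generated by \<open>S\<close>; for an additive subgroup \<open>S\<close> it is the set \<open>RS\<close> of finite
  sums of products.\<close>

definition gen_submodule :: "('a, 'm) ring_scheme \<Rightarrow> ('a, 'w) module \<Rightarrow> 'w set \<Rightarrow> 'w set" where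
  "gen_submodule R M S = \<Inter>{N. submodule N R M \<and> S \<subseteq> N}"

definition fin_gen :: "('a, 'm) ring_scheme \<Rightarrow> ('a, 'w) module \<Rightarrow> bool" where
  "fin_gen R M \<longleftrightarrow>
     (\<exists>S. finite S \<and> S \<subseteq> carrier M \<and> gen_submodule R M S = carrier M)"

text \<open>Direct summand of a free module. Index sets inside the type of \<open>M\<close> suffice, as \<open>M\<close> is a
  quotient of the free module on \<open>carrier M\<close>.\<close>

definition projective :: "('a, 'm) ring_scheme \<Rightarrow> ('a, 'w) module \<Rightarrow> bool" where
  "projective R M \<longleftrightarrow>
     (\<exists>(I :: 'w set) f g.
        f \<in> module_hom R M (free_module R I) \<and> g \<in> module_hom R (free_module R I) M \<and>
        (\<forall>x\<in>carrier M. g (f x) = x))"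


section \<open>Modules over a pair of rings\<close>

text \<open>In all that follows \<open>B\<close> is a commutative ring and \<open>A\<close> the underlying set of a subring.\<close>

definition pair_module :: "'b set \<times> 'b ring \<Rightarrow> 'w set \<times> ('b, 'w) module \<Rightarrow> bool" where
  "pair_module = (\<lambda>(A, B) (V, W).
     module B W \<and> fin_gen B W \<and> projective B W \<and>
     submodule V (B\<lparr>carrier := A\<rparr>) W \<and>
     gen_submodule B W V = carrier W)"

definition pair_hom ::
  "'b set \<times> 'b ring \<Rightarrow> 'v set \<times> ('b, 'v) module \<Rightarrow> 'w set \<times> ('b, 'w) module \<Rightarrow> ('v \<Rightarrow> 'w) set"
  where
  "pair_hom = (\<lambda>(A, B) (V\<^sub>1, W\<^sub>1) (V\<^sub>2, W\<^sub>2). {\<phi> \<in> module_hom B W\<^sub>1 W\<^sub>2. \<phi> ` V\<^sub>1 \<subseteq> V\<^sub>2})"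

definition pair_isomorphic ::
  "'b set \<times> 'b ring \<Rightarrow> 'v set \<times> ('b, 'v) module \<Rightarrow> 'w set \<times> ('b, 'w) module \<Rightarrow> bool" where
  "pair_isomorphic P M N \<longleftrightarrow>
     (\<exists>\<phi>\<in>pair_hom P M N. \<exists>\<psi>\<in>pair_hom P N M.
        (\<forall>x\<in>carrier (snd M). \<psi> (\<phi> x) = x) \<and> (\<forall>y\<in>carrier (snd N). \<phi> (\<psi> y) = y))"

definition pair_direct_sum ::
  "'v set \<times> ('b, 'v) module \<Rightarrow> 'w set \<times> ('b, 'w) module \<Rightarrow> ('v \<times> 'w) set \<times> ('b, 'v \<times> 'w) module"
  where
  "pair_direct_sum = (\<lambda>(V\<^sub>1, W\<^sub>1) (V\<^sub>2, W\<^sub>2). (V\<^sub>1 \<times> V\<^sub>2, direct_sum W\<^sub>1 W\<^sub>2))"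

definition pair_zero :: "'w set \<times> ('b, 'w) module \<Rightarrow> bool" where
  "pair_zero M \<longleftrightarrow> carrier (snd M) = {\<zero>\<^bsub>snd M\<^esub>}"

text \<open>The summands may be taken to live in the type of \<open>M\<close>, because each of them is isomorphic to a
  submodule of \<open>M\<close>.\<close>

definition pair_indecomposable :: "'b set \<times> 'b ring \<Rightarrow> 'w set \<times> ('b, 'w) module \<Rightarrow> bool" where
  "pair_indecomposable P M \<longleftrightarrow>
     pair_module P M \<and> \<not> pair_zero M \<and>
     (\<forall>(M\<^sub>1 :: 'w set \<times> ('b, 'w) module) (M\<^sub>2 :: 'w set \<times> ('b, 'w) module).
        pair_module P M\<^sub>1 \<and> pair_module P M\<^sub>2 \<and> pair_isomorphic P M (pair_direct_sum M\<^sub>1 M\<^sub>2) \<longrightarrow>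
        pair_zero M\<^sub>1 \<or> pair_zero M\<^sub>2)"


section \<open>The conductor and the associated Artinian pair\<close>

text \<open>Here \<open>S\<close> is the integral closure of a ring and \<open>T\<close> is that ring, as a subset of \<open>S\<close>.\<close>

definition conductor :: "('a, 'm) ring_scheme \<Rightarrow> 'a set \<Rightarrow> 'a set" where
  "conductor S T = {r \<in> T. \<forall>s\<in>carrier S. r \<otimes>\<^bsub>S\<^esub> s \<in> T}"

definition artinian_pair_of :: "('a, 'm) ring_scheme \<Rightarrow> 'a set \<Rightarrow> 'a set set \<times> 'a set ring" where
  "artinian_pair_of S T =
     ((\<lambda>r. conductor S T +>\<^bsub>S\<^esub> r) ` T, S Quot conductor S T)"


section \<open>The ring \<open>k[[x,y]]/((x\<^sup>3 - y\<^sup>7)x)\<close>\<close>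

text \<open>An element of \<open>k[[x,y]]\<close> is a power series in \<open>x\<close> whose coefficients are power series in \<open>y\<close>.\<close>

abbreviation pow1 :: "'k::field fps ring" where
  "pow1 \<equiv> ring_of_type_algebra"

abbreviation pow2 :: "'k::field fps fps ring" where
  "pow2 \<equiv> ring_of_type_algebra"

definition X2 :: "'k::field fps fps" where "X2 = fps_X"
definition Y2 :: "'k::field fps fps" where "Y2 = fps_const fps_X"

definition R_ideal :: "'k::field fps fps set" where
  "R_ideal = PIdl\<^bsub>pow2\<^esub> ((X2 ^ 3 - Y2 ^ 7) * X2)"

definition R_ring :: "'k::field fps fps set ring" where
  "R_ring = pow2 Quot R_ideal"

definition P1 :: "'k::field fps fps set set" where
  "P1 = (\<lambda>F. R_ideal +>\<^bsub>pow2\<^esub> F) ` (PIdl\<^bsub>pow2\<^esub> (X2 ^ 3 - Y2 ^ 7))"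

definition P2 :: "'k::field fps fps set set" where
  "P2 = (\<lambda>F. R_ideal +>\<^bsub>pow2\<^esub> F) ` (PIdl\<^bsub>pow2\<^esub> X2)"

text \<open>The integral closure \<open>k[[t]] \<times> k[[y]]\<close>.\<close>

definition R_bar :: "('k::field fps \<times> 'k fps) ring" where
  "R_bar = RDirProd pow1 pow1"

text \<open>\<open>F(x,y) \<mapsto> F(t\<^sup>7,t\<^sup>3)\<close>.\<close>

definition subst_t :: "'k::field fps fps \<Rightarrow> 'k fps" where
  "subst_t F = Abs_fps (\<lambda>m. \<Sum>(i, j) | 7 * i + 3 * j = m. fps_nth (fps_nth F i) j)"

text \<open>\<open>F(x,y) \<mapsto> (F(t\<^sup>7,t\<^sup>3), F(0,y))\<close>, and the induced map on \<open>R\<close>.\<close>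

definition normalization :: "'k::field fps fps \<Rightarrow> 'k fps \<times> 'k fps" where
  "normalization F = (subst_t F, fps_nth F 0)"

definition R_embed :: "'k::field fps fps set \<Rightarrow> 'k fps \<times> 'k fps" where
  "R_embed r = the_elem (normalization ` r)"

definition R_art :: "('k::field fps \<times> 'k fps) set set \<times> ('k fps \<times> 'k fps) set ring" where
  "R_art = artinian_pair_of R_bar (R_embed ` carrier R_ring)"

definition B1 :: "'k::field fps set ring" where
  "B1 = pow1 Quot (PIdl\<^bsub>pow1\<^esub> (fps_X ^ 19))"

definition B2 :: "'k::field fps set ring" where
  "B2 = pow1 Quot (PIdl\<^bsub>pow1\<^esub> (fps_X ^ 7))"

text \<open>\<open>B\<^sub>1 \<times> B\<^sub>2\<^sup>(\<^sup>n\<^sup>)\<close> as a module over \<open>B\<close>, the second component of \<open>R_art\<close>. An element of \<open>B\<close> is a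
  coset of the conductor \<open>(t\<^sup>1\<^sup>9) \<times> (y\<^sup>7)\<close>, that is the product of a coset of \<open>(t\<^sup>1\<^sup>9)\<close> and one of
  \<open>(y\<^sup>7)\<close>; the projections of \<open>B\<close> onto \<open>B\<^sub>1\<close> and \<open>B\<^sub>2\<close> are therefore the images of cosets under
  \<^const>\<open>fst\<close> and \<^const>\<open>snd\<close> (see \<open>B_iso\<close> below).\<close>

definition W_module ::
  "nat \<Rightarrow> (('k::field fps \<times> 'k fps) set, 'k fps set \<times> (nat \<Rightarrow> 'k fps set)) module" where
  "W_module n =
     direct_sum (restrict_scalars (image fst) (regular_module B1))
                (restrict_scalars (image snd) (free_module B2 {..<n}))"


section \<open>Consistency with the description of \<open>R\<close> and its integral closure\<close>

lemma ring_of_type_algebra_simps [simp]: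
  "carrier (ring_of_type_algebra :: 'a::comm_ring_1 ring) = UNIV"
  "monoid.mult (ring_of_type_algebra :: 'a ring) = (*)"
  "one (ring_of_type_algebra :: 'a ring) = 1"
  "ring.zero (ring_of_type_algebra :: 'a ring) = 0"
  "add (ring_of_type_algebra :: 'a ring) = (+)"
  by (auto simp: ring_of_type_algebra_def)

lemma R_bar_simps [simp]:
  "carrier R_bar = UNIV"
  "monoid.mult R_bar p q = (fst p * fst q, snd p * snd q)"
  "one R_bar = (1, 1)"
  "ring.zero R_bar = (0, 0)"
  "add R_bar p q = (fst p + fst q, snd p + snd q)"
  by (auto simp: R_bar_def RDirProd_def DirProd_def monoid.defs case_prod_beta)

lemma PIdl_type [simp]:
  "PIdl\<^bsub>ring_of_type_algebra\<^esub> (a :: 'a::comm_ring_1) = {F. a dvd F}"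
  by (auto simp: cgenideal_def dvd_def mult.commute)

lemma finite_index73: "finite {(i, j). 7 * i + 3 * j = (m::nat)}"
  by (rule finite_subset[of _ "{..m} \<times> {..m}"]) auto

lemma subst_t_nth:
  "fps_nth (subst_t F) m = (\<Sum>(i, j) | 7 * i + 3 * j = m. fps_nth (fps_nth F i) j)"
  by (simp add: subst_t_def)

lemma subst_t_add: "subst_t (F + G) = subst_t F + subst_t G"
  by (rule fps_ext) (simp add: subst_t_nth sum.distrib case_prod_beta)

lemma subst_t_mult: "subst_t (F * G) = subst_t F * subst_t G"
proof (rule fps_ext)
  fix m
  let ?F = "\<lambda>(i, j). fps_nth (fps_nth F i) j" and ?G = "\<lambda>(i, j). fps_nth (fps_nth G i) j"
  let ?I = "\<lambda>m. {(i, j). 7 * i + 3 * j = (m::nat)}"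
  have "fps_nth (subst_t (F * G)) m =
      (\<Sum>p\<in>?I m. \<Sum>q\<in>{0..fst p} \<times> {0..snd p}. ?F q * ?G (fst p - fst q, snd p - snd q))"
    unfolding subst_t_nth
    by (intro sum.cong refl)
       (auto simp: fps_mult_nth fps_sum_nth sum.cartesian_product case_prod_beta)
  also have "\<dots> = (\<Sum>(p, q)\<in>(SIGMA p:?I m. {0..fst p} \<times> {0..snd p}).
      ?F q * ?G (fst p - fst q, snd p - snd q))"
    by (subst sum.Sigma) (auto simp: finite_index73)
  also have "\<dots> = (\<Sum>(d, (q, r))\<in>(SIGMA d:{0..m}. ?I d \<times> ?I (m - d)). ?F q * ?G r)"
    by (rule sum.reindex_bij_witness
          [where i = "\<lambda>(d, (q, r)). ((fst q + fst r, snd q + snd r), q)"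
             and j = "\<lambda>(p, q). (7 * fst q + 3 * snd q, (q, (fst p - fst q, snd p - snd q)))"])
       (auto simp: algebra_simps)
  also have "\<dots> = (\<Sum>d=0..m. \<Sum>(q, r)\<in>?I d \<times> ?I (m - d). ?F q * ?G r)"
    by (subst sum.Sigma) (auto simp: finite_index73)
  also have "\<dots> = fps_nth (subst_t F * subst_t G) m"
    unfolding fps_mult_nth subst_t_nth
    by (intro sum.cong refl) (simp add: sum_product sum.cartesian_product case_prod_beta)
  finally show "fps_nth (subst_t (F * G)) m = fps_nth (subst_t F * subst_t G) m" .
qed

lemma subst_t_single:
  assumes "\<And>i' j'. fps_nth (fps_nth F i') j' = (if i' = i \<and> j' = j then c else 0)"
  shows "subst_t F = fps_const c * fps_X ^ (7 * i + 3 * j)"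
proof (rule fps_ext)
  fix m
  have "fps_nth (subst_t F) m =
      (\<Sum>p\<in>{(i, j). 7 * i + 3 * j = m}. if p = (i, j) then c else 0)"
    unfolding subst_t_nth by (intro sum.cong refl) (clarsimp simp: assms split: if_splits)
  also have "\<dots> = fps_nth (fps_const c * fps_X ^ (7 * i + 3 * j)) m"
    by (simp add: sum.delta[OF finite_index73])
  finally show "fps_nth (subst_t F) m = fps_nth (fps_const c * fps_X ^ (7 * i + 3 * j)) m" .
qed

lemma subst_t_X2: "subst_t X2 = fps_X ^ 7"
  by (subst subst_t_single[of X2 1 0 1]) (auto simp: X2_def fps_X_def)

lemma subst_t_Y2: "subst_t Y2 = fps_X ^ 3"
  by (subst subst_t_single[of Y2 0 1 1]) (auto simp: Y2_def)

lemma subst_t_1: "subst_t 1 = 1"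
  by (subst subst_t_single[of 1 0 0 1]) auto

lemma subst_t_power: "subst_t (F ^ n) = subst_t F ^ n"
  by (induction n) (auto simp: subst_t_1 subst_t_mult)

lemma subst_t_diff: "subst_t (F - G) = subst_t F - subst_t G"
  using subst_t_add[of "F - G" G] by (simp add: algebra_simps)

lemma normalization_X2: "normalization X2 = (fps_X ^ 7, 0)"
  by (simp add: normalization_def subst_t_X2) (simp add: X2_def)

lemma normalization_Y2: "normalization Y2 = (fps_X ^ 3, fps_X)"
  by (simp add: normalization_def subst_t_Y2) (simp add: Y2_def)

lemma X2_dvd_iff: "X2 dvd F \<longleftrightarrow> fps_nth F 0 = 0"
proof
  assume "fps_nth F 0 = 0"
  hence "F = X2 * fps_shift 1 F" by (intro fps_ext) (auto simp: X2_def)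
  thus "X2 dvd F" by (rule dvdI)
qed (auto simp: X2_def)

lemma Y2_power: "Y2 ^ n = fps_const (fps_X ^ n)"
  by (simp add: Y2_def fps_const_power)

lemma subst_t_eq_0_iff: "subst_t F = 0 \<longleftrightarrow> (X2 ^ 3 - Y2 ^ 7) dvd F"
proof
  assume "(X2 ^ 3 - Y2 ^ 7) dvd F"
  then obtain G where "F = (X2 ^ 3 - Y2 ^ 7) * G" by blast
  thus "subst_t F = 0"
    by (simp add: subst_t_mult subst_t_diff subst_t_power subst_t_X2 subst_t_Y2
        flip: power_mult)
next
  assume 0: "subst_t F = 0"
  define f where "f = (\<lambda>i j. fps_nth (fps_nth F i) j)"
  define g where "g = (\<lambda>i m. \<Sum>l\<le>m div 7. f (i + 3 * l) (m - 7 * l))"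
  define G where "G = Abs_fps (\<lambda>i. Abs_fps (\<lambda>m. g (i + 3) m))"
  have g0: "g i m = 0" if "i < 3" for i m
  proof -
    have "g i m = (\<Sum>(i', j') | 7 * i' + 3 * j' = 7 * i + 3 * m. f i' j')"
      unfolding g_def
    proof (rule sum.reindex_bij_witness
          [where i = "\<lambda>(i', j'). (i' - i) div 3" and j = "\<lambda>l. (i + 3 * l, m - 7 * l)"])
      fix p assume "p \<in> {(i', j'). 7 * i' + 3 * j' = 7 * i + 3 * m}"
      then obtain i' j' where p: "p = (i', j')" "7 * i' + 3 * j' = 7 * i + 3 * m" by auto
      have "i \<le> i'" and "(i' - i) mod 3 = 0" using p(2) that by presburger+
      then obtain l where l: "i' = i + 3 * l"
        by (metis add_diff_inverse_nat linorder_not_less mod_0_imp_dvd dvdE)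
      with p have j: "m = j' + 7 * l" by simp
      show "(case p of (i', j') \<Rightarrow> (i' - i) div 3) \<in> {..m div 7}"
        "(i + 3 * (case p of (i', j') \<Rightarrow> (i' - i) div 3),
          m - 7 * (case p of (i', j') \<Rightarrow> (i' - i) div 3)) = p"
        using p l j by auto
    qed auto
    also have "\<dots> = fps_nth (subst_t F) (7 * i + 3 * m)"
      by (simp add: subst_t_nth f_def)
    finally show ?thesis using 0 by simp
  qed
  have g_rec: "g i m = f i m + (if m < 7 then 0 else g (i + 3) (m - 7))" for i m
  proof (cases "m < 7")
    case False
    have "m div 7 = Suc ((m - 7) div 7)" using False by (simp add: le_div_geq)
    hence "g i m = f i m + (\<Sum>l\<le>(m - 7) div 7. f (i + 3 * Suc l) (m - 7 * Suc l))"
      unfolding g_def by (simp only: sum.atMost_Suc_shift) simp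
    also have "\<dots> = f i m + g (i + 3) (m - 7)"
      unfolding g_def by (simp add: algebra_simps)
    finally show ?thesis using False by simp
  qed (simp add: g_def)
  have "F = (X2 ^ 3 - Y2 ^ 7) * G"
  proof (intro fps_ext)
    fix i m
    have "fps_nth (fps_nth ((X2 ^ 3 - Y2 ^ 7) * G) i) m =
        g i m - (if m < 7 then 0 else g (i + 3) (m - 7))"
      by (cases "i < 3")
         (auto simp: g0 G_def left_diff_distrib X2_def Y2_power fps_X_power_mult_nth)
    also have "\<dots> = f i m" by (simp add: g_rec[of i m])
    finally show "fps_nth (fps_nth F i) m = fps_nth (fps_nth ((X2 ^ 3 - Y2 ^ 7) * G) i) m"
      by (simp add: f_def)
  qed
  thus "(X2 ^ 3 - Y2 ^ 7) dvd F" by simp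
qed

lemma R_ideal_dvd_iff:
  "(X2 ^ 3 - Y2 ^ 7) * X2 dvd F \<longleftrightarrow> (X2 ^ 3 - Y2 ^ 7) dvd F \<and> X2 dvd F"
proof (intro iffI conjI)
  assume "(X2 ^ 3 - Y2 ^ 7) dvd F \<and> X2 dvd F"
  hence F: "fps_nth F 0 = 0" and "(X2 ^ 3 - Y2 ^ 7) dvd F"
    by (auto simp: X2_dvd_iff)
  then obtain G where G: "F = (X2 ^ 3 - Y2 ^ 7) * G" by blast
  have "fps_nth F 0 = - (fps_X ^ 7) * fps_nth G 0"
    by (simp add: G Y2_power X2_def)
  with F have "X2 dvd G" by (simp add: X2_dvd_iff)
  thus "(X2 ^ 3 - Y2 ^ 7) * X2 dvd F" by (simp add: G mult_dvd_mono)
qed (auto dest: dvd_mult_left dvd_mult_right)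

lemma R_bar_cring: "cring (R_bar :: ('k::field fps \<times> 'k fps) ring)"
proof (rule cringI)
  have "ring (R_bar :: ('k fps \<times> 'k fps) ring)"
    unfolding R_bar_def by (intro RDirProd_ring ring_from_type_algebra)
  then interpret ring "R_bar :: ('k fps \<times> 'k fps) ring" .
  show "abelian_group (R_bar :: ('k fps \<times> 'k fps) ring)" by (rule is_abelian_group)
  show "comm_monoid (R_bar :: ('k fps \<times> 'k fps) ring)"
    by unfold_locales (auto simp: mult.commute)
qed (auto simp: algebra_simps)

lemma normalization_ring_hom: "ring_hom_ring pow2 R_bar normalization"
  by (intro ring_hom_ringI ring_from_type_algebra cring.axioms(1)[OF R_bar_cring])
     (auto simp: normalization_def subst_t_add subst_t_mult subst_t_1)

lemma normalization_kernel: "a_kernel pow2 R_bar normalization = R_ideal"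
  by (auto simp: a_kernel_def' R_ideal_def normalization_def subst_t_eq_0_iff
      R_ideal_dvd_iff X2_dvd_iff)

text \<open>\<open>R_embed\<close> is an injective ring homomorphism determined by its values on \<open>k[[x,y]]\<close>, and its two
  components have kernels \<open>P1\<close> and \<open>P2\<close>.\<close>

lemma R_embed_coset: "R_embed (R_ideal +>\<^bsub>pow2\<^esub> F) = normalization F"
  using ring_hom_ring.the_elem_simp[OF normalization_ring_hom, of F]
  by (simp add: R_embed_def normalization_kernel)

lemma R_embed_hom: "R_embed \<in> ring_hom R_ring R_bar"
  using ring_hom_ring.the_elem_hom[OF normalization_ring_hom]
  by (simp add: R_embed_def[abs_def] normalization_kernel R_ring_def)

lemma R_embed_inj: "inj_on R_embed (carrier R_ring)"
  using ring_hom_ring.the_elem_inj[OF normalization_ring_hom]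
  by (auto simp: R_embed_def[abs_def] normalization_kernel R_ring_def inj_on_def)

lemma carrier_R_ring: "carrier R_ring = range (\<lambda>F. R_ideal +>\<^bsub>pow2\<^esub> F)"
  by (auto simp: R_ring_def FactRing_def A_RCOSETS_def')

lemma R_embed_image: "R_embed ` carrier R_ring = range normalization"
  by (auto simp: carrier_R_ring image_image R_embed_coset)

lemma P1_eq: "P1 = {r \<in> carrier R_ring. fst (R_embed r) = 0}"
  by (auto simp: P1_def carrier_R_ring R_embed_coset normalization_def subst_t_eq_0_iff)

lemma P2_eq: "P2 = {r \<in> carrier R_ring. snd (R_embed r) = 0}"
  by (auto simp: P2_def carrier_R_ring R_embed_coset normalization_def X2_dvd_iff)

lemma subst_t_surj:
  assumes "fps_X ^ 12 dvd h"
  shows "\<exists>H. subst_t H = h"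
proof -
  define H where "H = Abs_fps (\<lambda>i. Abs_fps (\<lambda>j.
    if i < 3 \<and> 12 \<le> 7 * i + 3 * j then fps_nth h (7 * i + 3 * j) else 0))"
  have "fps_nth (subst_t H) m = fps_nth h m" for m
  proof (cases "m < 12")
    case True
    have "fps_nth (subst_t H) m = 0"
      unfolding subst_t_nth by (rule sum.neutral) (use True in \<open>auto simp: H_def\<close>)
    moreover have "fps_nth h m = 0"
      using assms True by (auto simp: fps_X_power_mult_nth elim!: dvdE)
    ultimately show ?thesis by simp
  next
    case False
    define i where "i = m mod 3"
    define j where "j = m div 3 - 2 * i"
    have "i < 3" by (simp add: i_def)
    moreover have "m div 3 \<ge> 4" using False div_le_mono[of 12 m 3] by simp
    moreover have "3 * (m div 3) + i = m" by (simp add: i_def)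
    ultimately have ij: "7 * i + 3 * j = m" unfolding j_def by linarith
    have "fps_nth (subst_t H) m =
        (\<Sum>p\<in>{(i, j). 7 * i + 3 * j = m}. if p = (i, j) then fps_nth h m else 0)"
      unfolding subst_t_nth
    proof (intro sum.cong refl, clarsimp simp: H_def simp del: prod.inject, goal_cases)
      case (1 a b)
      have "a < 3 \<longleftrightarrow> (a, b) = (i, j)" 
      proof
        assume "a < 3"
        have mod3: "(7 * a' + 3 * b') mod 3 = a' mod 3" for a' b' :: nat
        proof -
          have "7 * a' + 3 * b' = a' + (2 * a' + b') * 3" by simp
          thus ?thesis by (simp only: mod_mult_self1)
        qed
        have "7 * a + 3 * b = 7 * i + 3 * j" using 1 ij by simp
        moreover from this have "a mod 3 = i mod 3" by (metis mod3)
        hence "a = i" using \<open>a < 3\<close> \<open>i < 3\<close> by simp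
        ultimately show "(a, b) = (i, j)" by simp
      qed (use \<open>i < 3\<close> in simp)
      thus ?case using 1 False by auto
    qed
    also have "\<dots> = fps_nth h m"
      using ij by (simp add: sum.delta[OF finite_index73])
    finally show ?thesis .
  qed
  thus ?thesis by (intro exI[of _ H] fps_ext)
qed

lemma conductor_subset_R:
  assumes "fps_X ^ 19 dvd f" "fps_X ^ 7 dvd g"
  shows "(f, g) \<in> range normalization"
proof -
  obtain f' g' where f: "f = fps_X ^ 19 * f'" and g: "g = fps_X ^ 7 * g'"
    using assms by blast
  obtain H where H: "subst_t H = fps_X ^ 12 * f'" using subst_t_surj[of "fps_X ^ 12 * f'"] by auto
  have "normalization (X2 * H - (X2 ^ 3 - Y2 ^ 7) * fps_const g') = (f, g)"
    by (simp add: normalization_def subst_t_diff subst_t_mult subst_t_power subst_t_X2 subst_t_Y2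
        H f g mult.assoc flip: power_mult power_add)
       (simp add: X2_def Y2_power flip: mult.assoc power_add)
  thus ?thesis by (metis rangeI)
qed

lemma conductor_eq:
  "conductor R_bar (R_embed ` carrier R_ring) =
     {f :: 'a::field fps. fps_X ^ 19 dvd f} \<times> {g. fps_X ^ 7 dvd g}"
  (is "?C = _")
proof (intro equalityI subsetI)
  fix p assume p: "p \<in> ?C"
  obtain f g :: "'a fps" where [simp]: "p = (f, g)" by force
  have mult: "(f * u, g * v) \<in> range normalization" for u v
    using p by (auto simp: conductor_def R_embed_image)
  have "fps_X ^ 19 dvd f"
  proof (rule ccontr)
    assume nd: "\<not> fps_X ^ 19 dvd f"
    hence "f \<noteq> 0" by auto
    define d where "d = subdegree f"
    define u where "u = fps_shift d f"
    have f: "f = u * fps_X ^ d" unfolding u_def d_def by (rule subdegree_decompose)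
    have u0: "fps_nth u 0 \<noteq> 0" using \<open>f \<noteq> 0\<close> by (simp add: u_def d_def)
    have "d \<le> 18"
    proof (rule ccontr)
      assume "\<not> d \<le> 18"
      hence "fps_X ^ 19 dvd fps_X ^ d" by (intro le_imp_power_dvd) simp
      hence "fps_X ^ 19 dvd f" unfolding f by (rule dvd_mult)
      with nd show False by simp
    qed
    have "f * (inverse u * fps_X ^ (18 - d)) = (u * inverse u) * fps_X ^ (d + (18 - d))"
      unfolding f power_add by (simp only: mult_ac)
    also have "\<dots> = fps_X ^ 18"
      using u0 \<open>d \<le> 18\<close> by (simp add: inverse_mult_eq_1')
    finally have "(fps_X ^ 18 :: 'a fps, 0) \<in> range normalization"
      using mult[of "inverse u * fps_X ^ (18 - d)" 0] by (simp only: mult_zero_right)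
    then obtain F :: "'a fps fps" where "(fps_X ^ 18, 0) = normalization F" by blast
    hence F: "subst_t F = fps_X ^ 18" "fps_nth F 0 = 0"
      by (simp_all add: normalization_def)
    then obtain H where "F = X2 * H" using X2_dvd_iff by blast
    with F(1) have "fps_X ^ 7 * subst_t H = fps_X ^ 7 * fps_X ^ 11"
      by (simp add: subst_t_mult subst_t_X2 flip: power_add)
    hence "subst_t H = fps_X ^ 11"
      by (metis mult_cancel_left fps_X_neq_zero power_not_zero)
    hence "fps_nth (subst_t H) 11 = 1" by simp
    moreover have "{(i, j). 7 * i + 3 * j = (11::nat)} = {}" by auto presburger
    ultimately show False by (simp add: subst_t_nth)
  qed
  moreover have "fps_X ^ 7 dvd g"
  proof -
    have "(0, g) \<in> range normalization" using mult[of 0 1] by simp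
    then obtain F where F: "subst_t F = 0" "fps_nth F 0 = g"
      by (auto simp: normalization_def)
    then obtain G where "F = (X2 ^ 3 - Y2 ^ 7) * G" by (auto simp only: subst_t_eq_0_iff dvd_def)
    with F(2) have "g = fps_X ^ 7 * (- fps_nth G 0)" by (simp add: Y2_power X2_def)
    thus ?thesis by (rule dvdI)
  qed
  ultimately show "p \<in> {f. fps_X ^ 19 dvd f} \<times> {g. fps_X ^ 7 dvd g}" by simp
qed (auto simp: conductor_def R_embed_image intro!: conductor_subset_R)

text \<open>The total quotient ring of \<open>R\<close> is \<open>k((t)) \<times> k((y))\<close>, and \<open>R_bar\<close> is the integral closure of \<open>R\<close>
  in it.\<close>

lemma total_quotient:
  fixes q\<^sub>1 q\<^sub>2 :: "'k::field fls"
  shows "\<exists>(f, g)\<in>range normalization. \<exists>(s, u)\<in>range normalization.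
           s \<noteq> 0 \<and> u \<noteq> 0 \<and> q\<^sub>1 = fps_to_fls f / fps_to_fls s \<and> q\<^sub>2 = fps_to_fls g / fps_to_fls u"
proof -
  have frac: "\<exists>f s. s \<noteq> 0 \<and> fps_X ^ 19 dvd f \<and> fps_X ^ 19 dvd s \<and> q = fps_to_fls f / fps_to_fls s"
    for q :: "'k fls"
  proof -
    define d where "d = nat (- fls_subdegree q)"
    define f where "f = fls_regpart (fls_X ^ d * q)"
    have "fls_subdegree (fls_X ^ d * q) \<ge> 0"
      by (cases "q = 0") (auto simp: d_def)
    hence "fps_to_fls f = fls_X ^ d * q"
      unfolding f_def by simp
    have "fps_to_fls (fps_X ^ 19 * f) = q * fps_to_fls (fps_X ^ (19 + d))"
      by (simp only: fls_times_fps_to_fls fps_to_fls_power power_add fps_X_to_fls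
          \<open>fps_to_fls f = fls_X ^ d * q\<close> mult_ac)
    hence "q = fps_to_fls (fps_X ^ 19 * f) / fps_to_fls (fps_X ^ (19 + d))"
      by (simp only:) (rule nonzero_mult_div_cancel_right[symmetric], simp)
    thus ?thesis
      by (intro exI[of _ "fps_X ^ 19 * f"] exI[of _ "fps_X ^ (19 + d)"]) (auto simp: power_add)
  qed
  have 7: "fps_X ^ 7 dvd f" if "fps_X ^ 19 dvd f" for f :: "'k fps"
    by (rule dvd_trans[OF le_imp_power_dvd that]) simp
  obtain f s g u where
    "s \<noteq> 0" "fps_X ^ 19 dvd f" "fps_X ^ 19 dvd s" "q\<^sub>1 = fps_to_fls f / fps_to_fls s"
    "u \<noteq> 0" "fps_X ^ 19 dvd g" "fps_X ^ 19 dvd u" "q\<^sub>2 = fps_to_fls g / fps_to_fls u"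
    using frac[of q\<^sub>1] frac[of q\<^sub>2] by blast
  moreover from this have "(f, g) \<in> range normalization" "(s, u) \<in> range normalization"
    by (simp_all only: conductor_subset_R 7)
  ultimately show ?thesis by blast
qed

lemma fls_integral:
  fixes q :: "'k::field fls"
  assumes "q ^ n + (\<Sum>i<n. fps_to_fls (a i) * q ^ i) = 0"
  shows "q \<in> range fps_to_fls"
proof -
  have "fls_subdegree q \<ge> 0"
  proof (rule ccontr)
    assume neg: "\<not> fls_subdegree q \<ge> 0"
    define d where "d = fls_subdegree q"
    have q0: "q \<noteq> 0" using neg by auto
    have "fls_nth (fps_to_fls (a i) * q ^ i) (int n * d) = 0" if "i < n" for i
    proof (cases "a i = 0")
      case False
      have "int n * d < int i * d" using neg that by (simp add: d_def)
      also have "\<dots> \<le> fls_subdegree (fps_to_fls (a i) * q ^ i)"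
        using False q0 by (simp add: d_def fls_subdegree_fls_to_fps fls_subdegree_pow)
      finally show ?thesis by (rule fls_eq0_below_subdegree)
    qed simp
    hence "fls_nth (\<Sum>i<n. fps_to_fls (a i) * q ^ i) (int n * d) = 0"
      by (simp add: fls_nth_sum)
    moreover have "fls_nth (q ^ n) (int n * d) \<noteq> 0"
      using q0 nth_fls_subdegree_nonzero[of "q ^ n"] by (simp add: fls_subdegree_pow d_def)
    ultimately have "fls_nth (q ^ n + (\<Sum>i<n. fps_to_fls (a i) * q ^ i)) (int n * d) \<noteq> 0"
      by simp
    with assms show False by simp
  qed
  hence "fps_to_fls (fls_regpart q) = q" by simp
  thus ?thesis by (metis rangeI)
qed

lemma integral_over_R:
  fixes f g :: "'k::field fps"
  shows "\<exists>n a b. (\<forall>i<n. (a i, b i) \<in> range normalization) \<and>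
           f ^ n + (\<Sum>i<n. a i * f ^ i) = 0 \<and> g ^ n + (\<Sum>i<n. b i * g ^ i) = 0"
proof -
  define C where "C = range (fps_const :: 'k \<Rightarrow> 'k fps)"
  have C_mult: "x * y \<in> C" and C_add: "x + y \<in> C" if "x \<in> C" "y \<in> C" for x y
    using that by (auto simp: C_def)
  have C_0: "0 \<in> C" and C_1: "1 \<in> C"
    unfolding C_def by (metis fps_const_0_eq_0 rangeI, metis fps_const_1_eq_1 rangeI)
  have C_sum: "sum h A \<in> C" if "\<And>x. x \<in> A \<Longrightarrow> h x \<in> C" for h :: "nat \<Rightarrow> 'k fps" and A
    using that by (induction A rule: infinite_finite_induct) (auto intro: C_add C_0)
  define P where "P = {p :: 'k fps poly. \<forall>i. poly.coeff p i \<in> C}"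
  have P_mult: "p * q \<in> P" if "p \<in> P" "q \<in> P" for p q
    using that by (auto simp: P_def coeff_mult intro!: C_sum C_mult)
  have P_lin: "[:- fps_const c, 1:] \<in> P" for c
    using C_0 C_1 by (auto simp: P_def coeff_pCons C_def split: nat.splits intro!: range_eqI[of _ _ "-c"])
  have P_1: "1 \<in> P" using C_0 C_1 by (auto simp: P_def coeff_1)
  define l where "l = (\<lambda>h :: 'k fps. [:- fps_const (fps_nth h 0), 1:])"
  define p where "p = (l f * l g) ^ 19"
  have p: "p \<in> P"
  proof -
    have "(l f * l g) ^ m \<in> P" for m
      by (induction m) (simp add: P_1, unfold power_Suc l_def, intro P_mult P_lin)
    thus ?thesis by (simp add: p_def)
  qed
  have deg: "Polynomial.degree p = 38" "poly.coeff p 38 = 1"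
  proof -
    have l: "Polynomial.degree (l h) = 1" "l h \<noteq> 0" "lead_coeff (l h) = 1" for h by (auto simp: l_def)
    show 1: "Polynomial.degree p = 38"
      unfolding p_def using l by (simp add: degree_power_eq degree_mult_eq)
    have "lead_coeff p = 1"
      unfolding p_def using l by (simp add: lead_coeff_power lead_coeff_mult)
    thus "poly.coeff p 38 = 1" by (simp add: 1)
  qed
  have eval: "poly p h = h ^ 38 + (\<Sum>i<38. poly.coeff p i * h ^ i)" for h
    unfolding poly_altdef deg
    by (subst lessThan_Suc_atMost[symmetric], subst sum.lessThan_Suc) (simp add: deg)
  have X: "fps_X dvd h - fps_const (fps_nth h 0)" for h :: "'k fps"
  proof
    show "h - fps_const (fps_nth h 0) = fps_X * fps_shift 1 h" by (rule fps_ext) auto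
  qed
  have dvd: "fps_X ^ 19 dvd poly p f" "fps_X ^ 19 dvd poly p g"
  proof -
    have "poly (l h) h = h - fps_const (fps_nth h 0)" for h by (simp add: l_def)
    hence "fps_X dvd poly (l f * l g) f" "fps_X dvd poly (l f * l g) g"
      unfolding poly_mult using X by (metis dvd_mult2, metis dvd_mult)
    thus "fps_X ^ 19 dvd poly p f" "fps_X ^ 19 dvd poly p g"
      unfolding p_def poly_power by (simp_all only: dvd_power_same)
  qed
  have r: "(poly p f, poly p g) \<in> range normalization"
    by (rule conductor_subset_R dvd dvd_trans[OF le_imp_power_dvd dvd(2)])+ simp
  have const: "(c, c) \<in> range normalization" if "c \<in> C" for c
  proof -
    from that obtain c' where "c = fps_const c'" by (auto simp: C_def)
    hence "normalization (fps_const c) = (c, c)"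
      by (auto simp: normalization_def intro!: subst_t_single[of _ 0 0 c', THEN trans])
    thus ?thesis by (metis rangeI)
  qed
  have diff: "(u - u', v - v') \<in> range normalization"
    if "(u, v) \<in> range normalization" "(u', v') \<in> range normalization" for u v u' v'
  proof -
    from that obtain F G where "normalization F = (u, v)" "normalization G = (u', v')" by force
    hence "normalization (F - G) = (u - u', v - v')"
      by (simp add: normalization_def subst_t_diff)
    thus ?thesis by (metis rangeI)
  qed
  define a where "a = (\<lambda>h i. poly.coeff p i - (if i = 0 then poly p h else 0))"
  have "h ^ 38 + (\<Sum>i<38. a h i * h ^ i) = 0" for h
  proof -
    have "(\<Sum>i<38. a h i * h ^ i) =
        (\<Sum>i<38. poly.coeff p i * h ^ i) - (\<Sum>i<(38::nat). if i = 0 then poly p h else 0)"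
      unfolding a_def sum_subtractf[symmetric] by (intro sum.cong) (auto simp: algebra_simps)
    thus ?thesis by (simp add: eval)
  qed
  moreover have "(a f i, a g i) \<in> range normalization" for i
    using p diff[OF const r] const by (auto simp: a_def P_def)
  ultimately show ?thesis by blast
qed

theorem R_bar_integral_closure:
  fixes q\<^sub>1 q\<^sub>2 :: "'k::field fls"
  shows "(q\<^sub>1, q\<^sub>2) \<in> map_prod fps_to_fls fps_to_fls ` carrier R_bar \<longleftrightarrow>
    (\<exists>n a b. (\<forall>i<n. (a i, b i) \<in> R_embed ` carrier R_ring) \<and>
       q\<^sub>1 ^ n + (\<Sum>i<n. fps_to_fls (a i) * q\<^sub>1 ^ i) = 0 \<and>
       q\<^sub>2 ^ n + (\<Sum>i<n. fps_to_fls (b i) * q\<^sub>2 ^ i) = 0)" (is "?L \<longleftrightarrow> ?R")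
proof
  assume ?L
  then obtain f g where [simp]: "q\<^sub>1 = fps_to_fls f" "q\<^sub>2 = fps_to_fls g" by auto
  obtain n a b where *: "\<forall>i<n. (a i, b i) \<in> range normalization"
    "f ^ n + (\<Sum>i<n. a i * f ^ i) = 0" "g ^ n + (\<Sum>i<n. b i * g ^ i) = 0"
    using integral_over_R[of f g] by blast
  have fls_sum: "fps_to_fls (sum c A) = (\<Sum>i\<in>A. fps_to_fls (c i))" for c :: "nat \<Rightarrow> 'k fps" and A
    by (induction A rule: infinite_finite_induct) auto
  have "fps_to_fls (h ^ n + (\<Sum>i<n. c i * h ^ i)) =
      fps_to_fls h ^ n + (\<Sum>i<n. fps_to_fls (c i) * fps_to_fls h ^ i)" for h and c :: "nat \<Rightarrow> 'k fps"
    by (simp add: fps_to_fls_power fls_sum fls_times_fps_to_fls )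
  from this[of f a] this[of g b] * show ?R
    by (intro exI[of _ n] exI[of _ a] exI[of _ b]) (auto simp: R_embed_image)
next
  assume ?R
  then obtain n a b where
    "q\<^sub>1 ^ n + (\<Sum>i<n. fps_to_fls (a i) * q\<^sub>1 ^ i) = 0"
    "q\<^sub>2 ^ n + (\<Sum>i<n. fps_to_fls (b i) * q\<^sub>2 ^ i) = 0" by blast
  hence "q\<^sub>1 \<in> range fps_to_fls" "q\<^sub>2 \<in> range fps_to_fls" by (blast intro: fls_integral)+
  thus ?L by (auto simp: image_iff)
qed

text \<open>\<open>B\<close> is \<open>B\<^sub>1 \<times> B\<^sub>2\<close>, \<open>A\<close> is a subring of it, and \<open>W_module n\<close> is a \<open>B\<close>-module.\<close>

lemma conductor_ideal: "ideal (conductor R_bar (R_embed ` carrier R_ring)) R_bar"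
proof -
  interpret cring "R_bar :: ('k::field fps \<times> 'k fps) ring" by (rule R_bar_cring)
  have inv: "inv\<^bsub>add_monoid R_bar\<^esub> p = (- fst p, - snd p)" for p :: "'k fps \<times> 'k fps"
    using minus_equality[of "(- fst p, - snd p)" p] by (simp add: a_inv_def)
  show "ideal (conductor R_bar (R_embed ` carrier R_ring)) (R_bar :: ('k fps \<times> 'k fps) ring)"
    unfolding conductor_eq
    by (intro idealI subgroup.intro ring_axioms) (auto simp: inv[simplified])
qed

lemma R_art_snd_cring: "cring (snd R_art)"
  unfolding R_art_def artinian_pair_of_def snd_conv
  by (intro ideal.quotient_is_cring conductor_ideal R_bar_cring)

lemma PIdl_pow1_ideal: "ideal (PIdl\<^bsub>pow1\<^esub> f) pow1"
  by (intro cring.cgenideal_ideal cring_from_type_algebra) simp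

lemma B1_cring: "cring B1" and B2_cring: "cring B2"
  unfolding B1_def B2_def
  by (intro ideal.quotient_is_cring PIdl_pow1_ideal cring_from_type_algebra)+

lemma mem_PIdl_coset:
  fixes a f u :: "'a::comm_ring_1"
  shows "u \<in> PIdl\<^bsub>ring_of_type_algebra\<^esub> a +>\<^bsub>ring_of_type_algebra\<^esub> f \<longleftrightarrow> a dvd u - f"
proof
  assume "a dvd u - f"
  hence "u - f \<in> PIdl\<^bsub>ring_of_type_algebra\<^esub> a" "u = (u - f) + f" by simp_all
  thus "u \<in> PIdl\<^bsub>ring_of_type_algebra\<^esub> a +>\<^bsub>ring_of_type_algebra\<^esub> f"
    unfolding a_r_coset_def' by fastforce
qed (auto simp: a_r_coset_def')

lemma mem_conductor_coset:
  "(u, v) \<in> conductor R_bar (R_embed ` carrier R_ring) +>\<^bsub>R_bar\<^esub> (f, g) \<longleftrightarrow>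
     fps_X ^ 19 dvd u - f \<and> fps_X ^ 7 dvd v - g" (is "?L \<longleftrightarrow> ?R")
proof
  assume ?R
  hence "(u - f, v - g) \<in> conductor R_bar (R_embed ` carrier R_ring)"
    "(u, v) = (u - f, v - g) \<oplus>\<^bsub>R_bar\<^esub> (f, g)"
    by (simp_all add: conductor_eq)
  thus ?L unfolding a_r_coset_def' by blast
qed (auto simp: a_r_coset_def' conductor_eq)

lemma conductor_coset:
  "conductor R_bar (R_embed ` carrier R_ring) +>\<^bsub>R_bar\<^esub> (f, g) =
     (PIdl\<^bsub>pow1\<^esub> (fps_X ^ 19) +>\<^bsub>pow1\<^esub> f) \<times> (PIdl\<^bsub>pow1\<^esub> (fps_X ^ 7) +>\<^bsub>pow1\<^esub> g)"
  by (rule Set.set_eqI) (simp only: split_paired_all mem_Times_iff fst_conv snd_conv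
      mem_conductor_coset mem_PIdl_coset)

lemma fst_snd_coset:
  "fst ` (conductor R_bar (R_embed ` carrier R_ring) +>\<^bsub>R_bar\<^esub> (f, g)) =
     PIdl\<^bsub>pow1\<^esub> (fps_X ^ 19) +>\<^bsub>pow1\<^esub> f"
  "snd ` (conductor R_bar (R_embed ` carrier R_ring) +>\<^bsub>R_bar\<^esub> (f, g)) =
     PIdl\<^bsub>pow1\<^esub> (fps_X ^ 7) +>\<^bsub>pow1\<^esub> g"
proof -
  have "(PIdl\<^bsub>pow1\<^esub> h +>\<^bsub>pow1\<^esub> f) \<noteq> {}" for h f :: "'a fps"
    using mem_PIdl_coset[of f h f] by auto
  thus "fst ` (conductor R_bar (R_embed ` carrier R_ring) +>\<^bsub>R_bar\<^esub> (f, g)) =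
     PIdl\<^bsub>pow1\<^esub> (fps_X ^ 19) +>\<^bsub>pow1\<^esub> f"
  "snd ` (conductor R_bar (R_embed ` carrier R_ring) +>\<^bsub>R_bar\<^esub> (f, g)) =
     PIdl\<^bsub>pow1\<^esub> (fps_X ^ 7) +>\<^bsub>pow1\<^esub> g"
    unfolding conductor_coset by simp_all
qed

lemma carrier_R_art: "carrier (snd R_art) =
    range (\<lambda>p. conductor R_bar (R_embed ` carrier R_ring) +>\<^bsub>R_bar\<^esub> p)"
  by (auto simp: R_art_def artinian_pair_of_def FactRing_def A_RCOSETS_def')

lemma B_hom:
  "image fst \<in> ring_hom (snd R_art) (B1 :: 'a::field fps set ring)"
  "image snd \<in> ring_hom (snd R_art) (B2 :: 'a::field fps set ring)"
proof -
  let ?C = "conductor R_bar (R_embed ` carrier R_ring) :: ('a fps \<times> 'a fps) set"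
  let ?I = "PIdl\<^bsub>pow1\<^esub> (fps_X ^ 19) :: 'a fps set" and ?J = "PIdl\<^bsub>pow1\<^esub> (fps_X ^ 7) :: 'a fps set"
  define c where "c = (\<lambda>p. ?C +>\<^bsub>R_bar\<^esub> p)"
  define i where "i = (\<lambda>f. ?I +>\<^bsub>pow1\<^esub> f)"
  define j where "j = (\<lambda>f. ?J +>\<^bsub>pow1\<^esub> f)"
  define B :: "('a fps \<times> 'a fps) set ring" where "B = snd R_art"
  have q: "c \<in> ring_hom R_bar B" "i \<in> ring_hom pow1 B1" "j \<in> ring_hom pow1 B2"
    unfolding B_def R_art_def artinian_pair_of_def snd_conv B1_def B2_def c_def i_def j_def
    by (intro ideal.rcos_ring_hom conductor_ideal PIdl_pow1_ideal)+
  have carr: "carrier B = range c"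
    by (simp add: B_def c_def carrier_R_art)
  have fs: "fst ` c p = i (fst p)" "snd ` c p = j (snd p)" for p
    using fst_snd_coset[of "fst p" "snd p"] by (simp_all only: c_def i_def j_def prod.collapse)
  have ops: "c p \<otimes>\<^bsub>B\<^esub> c p' = c (fst p * fst p', snd p * snd p')"
    "c p \<oplus>\<^bsub>B\<^esub> c p' = c (fst p + fst p', snd p + snd p')" "\<one>\<^bsub>B\<^esub> = c (1, 1)" for p p'
    using ring_hom_mult[OF q(1)] ring_hom_add[OF q(1)] ring_hom_one[OF q(1)] by simp_all
  have I: "i f \<in> carrier B1" "i (f * f') = i f \<otimes>\<^bsub>B1\<^esub> i f'" "i (f + f') = i f \<oplus>\<^bsub>B1\<^esub> i f'"
    "i 1 = \<one>\<^bsub>B1\<^esub>" for f f'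
    using ring_hom_closed[OF q(2)] ring_hom_mult[OF q(2)] ring_hom_add[OF q(2)] ring_hom_one[OF q(2)]
    by simp_all
  have J: "j f \<in> carrier B2" "j (f * f') = j f \<otimes>\<^bsub>B2\<^esub> j f'" "j (f + f') = j f \<oplus>\<^bsub>B2\<^esub> j f'"
    "j 1 = \<one>\<^bsub>B2\<^esub>" for f f'
    using ring_hom_closed[OF q(3)] ring_hom_mult[OF q(3)] ring_hom_add[OF q(3)] ring_hom_one[OF q(3)]
    by simp_all
  have "image fst \<in> ring_hom B B1" "image snd \<in> ring_hom B B2"
  proof (rule_tac [!] ring_hom_memI, goal_cases)
    case (1 b) thus ?case by (auto simp only: carr fs I)
  next
    case (2 b b') then obtain p p' where "b = c p" "b' = c p'" unfolding carr by blast
    thus ?case by (simp only: fs ops I fst_conv)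
  next
    case (3 b b') then obtain p p' where "b = c p" "b' = c p'" unfolding carr by blast
    thus ?case by (simp only: fs ops I fst_conv)
  next
    case 4 show ?case by (simp only: fs ops I fst_conv)
  next
    case (5 b) thus ?case by (auto simp only: carr fs J)
  next
    case (6 b b') then obtain p p' where "b = c p" "b' = c p'" unfolding carr by blast
    thus ?case by (simp only: fs ops J snd_conv)
  next
    case (7 b b') then obtain p p' where "b = c p" "b' = c p'" unfolding carr by blast
    thus ?case by (simp only: fs ops J snd_conv)
  next
    case 8 show ?case by (simp only: fs ops J snd_conv)
  qed
  thus "image fst \<in> ring_hom (snd R_art) (B1 :: 'a fps set ring)"
    "image snd \<in> ring_hom (snd R_art) (B2 :: 'a fps set ring)"
    by (simp_all only: B_def)
qed

lemma B_iso: "(\<lambda>b. (fst ` b, snd ` b)) \<in> ring_iso (snd R_art) (RDirProd B1 B2)"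
proof -
  have hom: "(\<lambda>b. (fst ` b, snd ` b)) \<in> ring_hom (snd R_art) (RDirProd B1 B2)"
    by (rule ring_hom_memI)
       (simp_all add: RDirProd_def DirProd_def monoid.defs
          ring_hom_closed[OF B_hom(1)] ring_hom_mult[OF B_hom(1)] ring_hom_add[OF B_hom(1)]
          ring_hom_one[OF B_hom(1)]
          ring_hom_closed[OF B_hom(2)] ring_hom_mult[OF B_hom(2)] ring_hom_add[OF B_hom(2)]
          ring_hom_one[OF B_hom(2)])
  have "inj_on (\<lambda>b. (fst ` b, snd ` b)) (carrier (snd R_art))"
    by (auto simp: inj_on_def carrier_R_art fst_snd_coset conductor_coset)
  moreover have "carrier (RDirProd B1 B2) \<subseteq> (\<lambda>b. (fst ` b, snd ` b)) ` carrier (snd R_art)"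
    by (auto simp: RDirProd_carrier B1_def B2_def FactRing_def A_RCOSETS_def' carrier_R_art
        image_iff fst_snd_coset simp del: PIdl_type)
  ultimately show ?thesis
    using hom by (auto simp: ring_iso_def bij_betw_def dest: ring_hom_closed)
qed

lemma R_art_subring: "subring (fst R_art) (snd R_art)"
proof -
  let ?c = "\<lambda>p. conductor R_bar (R_embed ` carrier R_ring) +>\<^bsub>R_bar\<^esub> p"
  have "ring_hom_ring R_bar (snd R_art) ?c"
    unfolding R_art_def artinian_pair_of_def snd_conv
    by (intro ideal.rcos_ring_hom_ring conductor_ideal)
  moreover have "subring (normalization ` carrier pow2) R_bar"
    using normalization_ring_hom ring.carrier_is_subring[OF ring_from_type_algebra]
    by (rule ring_hom_ring.img_is_subring)
  ultimately have "subring (?c ` (normalization ` carrier pow2)) (snd R_art)"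
    by (rule ring_hom_ring.img_is_subring)
  thus ?thesis by (simp add: R_art_def artinian_pair_of_def R_embed_image)
qed

lemma regular_module_module:
  fixes R (structure)
  assumes "cring R"
  shows "module R (regular_module R)"
proof -
  interpret cring R by fact
  show ?thesis
    by (intro moduleI is_cring abelian_groupI)
       (auto simp: regular_module_def a_ac m_assoc l_distr r_distr intro: l_neg)
qed

lemma free_module_module:
  fixes R (structure)
  assumes "cring R"
  shows "module R (free_module R I)"
proof -
  interpret cring R by fact
  have fin: "finite {i \<in> I. f i \<oplus> g i \<noteq> \<zero>}"
    if "finite {i \<in> I. f i \<noteq> \<zero>}" "finite {i \<in> I. g i \<noteq> \<zero>}" for f g
    by (rule finite_subset[OF _ finite_UnI[OF that]]) auto
  have fin': "finite {i \<in> I. a \<otimes> f i \<noteq> \<zero>}"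
    if "finite {i \<in> I. f i \<noteq> \<zero>}" "a \<in> carrier R" for f a
    by (rule finite_subset[OF _ that(1)]) (use that in auto)
  have fin'': "finite {i \<in> I. \<ominus> f i \<noteq> \<zero>}"
    if "finite {i \<in> I. f i \<noteq> \<zero>}" for f
    by (rule finite_subset[OF _ that(1)]) auto
  show ?thesis
  proof (intro moduleI is_cring abelian_groupI, goal_cases)
    case (6 f)
    thus ?case
      by (intro bexI[of _ "\<lambda>i\<in>I. \<ominus> f i"])
         (auto simp: free_module_def fin'' PiE_def Pi_def l_neg fun_eq_iff extensional_def cong: conj_cong)
  qed (auto simp: free_module_def fin fin' PiE_iff a_ac m_assoc l_distr r_distr fun_eq_iff
        extensional_def cong: conj_cong)
qed

lemma restrict_scalars_module:
  assumes "cring S" "h \<in> ring_hom S R" "module R M"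
  shows "module S (restrict_scalars h M)"
proof -
  interpret module R M by fact
  note h = ring_hom_closed[OF assms(2)] ring_hom_add[OF assms(2)] ring_hom_mult[OF assms(2)]
    ring_hom_one[OF assms(2)]
  show ?thesis
    by (intro moduleI assms abelian_groupI)
       (auto simp: restrict_scalars_def h M.a_ac smult_l_distr smult_r_distr smult_assoc1
         intro: M.l_neg)
qed

lemma direct_sum_module:
  assumes "module R M" "module R N"
  shows "module R (direct_sum M N)"
proof -
  interpret M: module R M by fact
  interpret N: module R N by fact
  show ?thesis
  proof (intro moduleI M.is_cring abelian_groupI, goal_cases)
    case (6 p)
    thus ?case
      by (intro bexI[of _ "(\<ominus>\<^bsub>M\<^esub> fst p, \<ominus>\<^bsub>N\<^esub> snd p)"])
         (auto simp: direct_sum_def M.l_neg N.l_neg)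
  qed (auto simp: direct_sum_def M.M.a_ac N.M.a_ac M.smult_l_distr M.smult_r_distr
        M.smult_assoc1 N.smult_l_distr N.smult_r_distr N.smult_assoc1)
qed

lemma W_module_module: "module (snd R_art) (W_module n)"
  unfolding W_module_def
  by (intro direct_sum_module restrict_scalars_module[where R = B1]
      restrict_scalars_module[where R = B2] R_art_snd_cring B_hom regular_module_module
      free_module_module B1_cring B2_cring)

end

theory Submission
  imports Defs
begin

text \<open>As \<open>BV = W\<close>, the projection of \<open>V\<close> to \<open>B\<^sub>2\<^sup>(\<^sup>n\<^sup>)\<close> is surjective, so every basis vector \<open>e\<^sub>i\<close> lifts
  to some \<open>(f\<^sub>i, e\<^sub>i) \<in> V\<close>. The element \<open>c(y)\<close> of \<open>A\<close> acts as \<open>c(t\<^sup>3)\<close> on \<open>B\<^sub>1\<close>, and \<open>k[[t]]\<close> has rank \<open>3\<close>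
  over \<open>k[[t\<^sup>3]]\<close>; hence for \<open>n > 3\<close> there is a relation \<open>\<Sum>\<^sub>i c\<^sub>i(t\<^sup>3) f\<^sub>i = 0\<close>, which can be scaled so that
  some \<open>c\<^sub>i\<close> is \<open>1\<close>. Then \<open>(0, c) \<in> V\<close>, and the idempotent \<open>(p, q) \<mapsto> (0, q\<^sub>i c)\<close> of \<open>W\<close> maps \<open>V\<close> into
  itself, so it splits off the summand \<open>0 \<times> B\<^sub>2 c\<close>.\<close>

section \<open>Submodules of restricted modules and generated submodules\<close>

lemma submodule_restrict_iff:
  assumes "abelian_group M" "subgroup H (add_monoid M)"
  shows "submodule N R (M\<lparr>carrier := H\<rparr>) \<longleftrightarrow> submodule N R M \<and> N \<subseteq> H"
proof -
  interpret abelian_group M by fact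
  have "subgroup N ((add_monoid M)\<lparr>carrier := H\<rparr>) \<longleftrightarrow> subgroup N (add_monoid M) \<and> N \<subseteq> H"
    using group.incl_subgroup[OF a_group assms(2)] group.subgroup_incl[OF a_group _ assms(2)]
      subgroup.subset[of N "(add_monoid M)\<lparr>carrier := H\<rparr>"] by auto
  thus ?thesis by (auto simp: submodule_def submodule_axioms_def)
qed

lemma gen_submodule_submodule:
  assumes "module R M" "S \<subseteq> carrier M"
  shows "submodule (gen_submodule R M S) R M"
proof -
  interpret module R M by fact
  \<comment> \<open>The intersected family is nonempty, so the intersection stays inside
    \<open>carrier M\<close>.\<close>
  have car: "carrier M \<in> {N. submodule N R M \<and> S \<subseteq> N}"
    using assms(2) carrier_is_submodule by simp
  show ?thesis unfolding gen_submodule_def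
  proof (rule submoduleI)
    show "\<Inter> {N. submodule N R M \<and> S \<subseteq> N} \<subseteq> carrier M" using car by blast
  next
    show "\<zero>\<^bsub>M\<^esub> \<in> \<Inter> {N. submodule N R M \<and> S \<subseteq> N}"
      using subgroup.one_closed[OF submodule.axioms(1)] by fastforce
  qed (use submoduleE in auto)
qed

lemma gen_submodule_least:
  "\<lbrakk>submodule N R M; S \<subseteq> N\<rbrakk> \<Longrightarrow> gen_submodule R M S \<subseteq> N"
  by (auto simp: gen_submodule_def)

lemma subset_gen_submodule: "S \<subseteq> gen_submodule R M S"
  by (auto simp: gen_submodule_def)

section \<open>Images of endomorphisms, and direct sum decompositions from idempotents\<close>

locale module_endomorphism = module R M for R (structure) and M :: "('a, 'b) module" (structure) and e +
  assumes hom: "e \<in> module_hom R M M"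
begin

lemma closed: "x \<in> carrier M \<Longrightarrow> e x \<in> carrier M"
  and add: "\<lbrakk>x \<in> carrier M; y \<in> carrier M\<rbrakk> \<Longrightarrow> e (x \<oplus>\<^bsub>M\<^esub> y) = e x \<oplus>\<^bsub>M\<^esub> e y"
  and smult: "\<lbrakk>r \<in> carrier R; x \<in> carrier M\<rbrakk> \<Longrightarrow> e (r \<odot>\<^bsub>M\<^esub> x) = r \<odot>\<^bsub>M\<^esub> e x"
  using hom by (auto simp: module_hom_def)

lemma zero: "e \<zero>\<^bsub>M\<^esub> = \<zero>\<^bsub>M\<^esub>"
  by (metis M.add.l_cancel_one' M.zero_closed M.l_zero add closed)

lemma minus: "x \<in> carrier M \<Longrightarrow> e (\<ominus>\<^bsub>M\<^esub> x) = \<ominus>\<^bsub>M\<^esub> e x"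
  by (metis M.a_inv_closed M.l_neg M.minus_equality add closed zero)

text \<open>The scalars range over a subset \<open>A\<close> so that this covers both the
  \<open>A\<close>-submodule \<open>V\<close> and, with \<open>A\<close> the whole carrier,
  submodules over the full ring.\<close>

lemma submodule_image:
  assumes "submodule N (R\<lparr>carrier := A\<rparr>) M" "A \<subseteq> carrier R"
  shows "submodule (e ` N) (R\<lparr>carrier := A\<rparr>) M"
proof -
  interpret N: submodule N "R\<lparr>carrier := A\<rparr>" M by fact
  have N: "x \<in> carrier M" if "x \<in> N" for x using N.subset that by auto
  have "e ` N \<subseteq> carrier M" using N closed by blast
  moreover have "\<zero>\<^bsub>M\<^esub> \<in> e ` N" using N.one_closed zero by (metis image_eqI monoid.select_convs(2))
  moreover have "\<ominus>\<^bsub>M\<^esub> y \<in> e ` N" if y: "y \<in> e ` N" for y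
  proof -
    obtain x where x: "x \<in> N" "y = e x" using y by (rule imageE)
    have "\<ominus>\<^bsub>M\<^esub> x \<in> N" using N.m_inv_closed[OF x(1)] by (simp add: a_inv_def)
    moreover have "\<ominus>\<^bsub>M\<^esub> y = e (\<ominus>\<^bsub>M\<^esub> x)" using x N by (simp add: minus)
    ultimately show ?thesis by simp
  qed
  moreover have "y \<oplus>\<^bsub>M\<^esub> z \<in> e ` N" if yz: "y \<in> e ` N" "z \<in> e ` N" for y z
  proof -
    obtain x x' where x: "x \<in> N" "y = e x" "x' \<in> N" "z = e x'"
      using yz by (elim imageE)
    have "x \<oplus>\<^bsub>M\<^esub> x' \<in> N" using N.m_closed[OF x(1,3)] by simp
    moreover have "y \<oplus>\<^bsub>M\<^esub> z = e (x \<oplus>\<^bsub>M\<^esub> x')" using x N by (simp add: add)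
    ultimately show ?thesis by simp
  qed
  moreover have "a \<odot>\<^bsub>M\<^esub> y \<in> e ` N" if a: "a \<in> A" and y: "y \<in> e ` N" for a y
  proof -
    obtain x where x: "x \<in> N" "y = e x" using y by (rule imageE)
    have "a \<odot>\<^bsub>M\<^esub> x \<in> N" using N.smult_closed[of a x] a x by simp
    moreover have "a \<odot>\<^bsub>M\<^esub> y = e (a \<odot>\<^bsub>M\<^esub> x)" using x N smult a assms(2) by auto
    ultimately show ?thesis by blast
  qed
  ultimately show ?thesis
    by (simp add: submodule_def submodule_axioms_def subgroup_def a_inv_def)
qed

lemma submodule_image': "submodule N R M \<Longrightarrow> submodule (e ` N) R M"
  using submodule_image[of N "carrier R"] by (simp add: submodule_def submodule_axioms_def)

lemma submodule_vimage:
  assumes "submodule N R M"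
  shows "submodule {x \<in> carrier M. e x \<in> N} R M"
proof (rule submoduleI)
  show "\<zero>\<^bsub>M\<^esub> \<in> {x \<in> carrier M. e x \<in> N}"
    using subgroup.one_closed[OF submodule.axioms(1)[OF assms]] by (simp add: zero)
qed (use submoduleE[OF assms] in \<open>auto simp: add smult minus\<close>)

text \<open>The image keeps the type and operations of \<open>M\<close>, as
  \<open>pair_indecomposable\<close> requires of its summands.\<close>

abbreviation im where "im \<equiv> M\<lparr>carrier := e ` carrier M\<rparr>"

lemma submodule_im: "submodule (e ` carrier M) R M"
  by (rule submodule_image'[OF carrier_is_submodule])

lemma module_im: "module R im"
  using submodule.submodule_is_module[OF submodule_im module_axioms] .

lemma submodule_im_iff: "submodule N S im \<longleftrightarrow> submodule N S M \<and> N \<subseteq> e ` carrier M"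
  by (rule submodule_restrict_iff[OF M.abelian_group_axioms submodule.axioms(1)[OF submodule_im]])

lemma gen_submodule_image:
  assumes "S \<subseteq> carrier M" "gen_submodule R M S = carrier M"
  shows "gen_submodule R im (e ` S) = e ` carrier M"
proof
  have "submodule (e ` carrier M) R im" by (simp add: submodule_im_iff submodule_im)
  thus "gen_submodule R im (e ` S) \<subseteq> e ` carrier M"
    by (rule gen_submodule_least) (use assms in blast)
next
  \<comment> \<open>The preimage of \<open>N\<close> under \<open>e\<close> is a submodule
    containing the generators \<open>S\<close>, hence all of \<open>M\<close>.\<close>
  define N where "N = gen_submodule R im (e ` S)"
  have "submodule N R im" unfolding N_def
    by (rule gen_submodule_submodule[OF module_im]) (use assms in auto)
  hence "submodule {x \<in> carrier M. e x \<in> N} R M"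
    by (simp add: submodule_im_iff submodule_vimage)
  moreover have "S \<subseteq> {x \<in> carrier M. e x \<in> N}"
    using subset_gen_submodule[of "e ` S" R im] assms(1) by (auto simp: N_def)
  ultimately have "carrier M \<subseteq> {x \<in> carrier M. e x \<in> N}"
    using gen_submodule_least assms(2) by metis
  thus "e ` carrier M \<subseteq> gen_submodule R im (e ` S)" by (auto simp: N_def)
qed

lemma fin_gen_im:
  assumes "fin_gen R M"
  shows "fin_gen R im"
proof -
  obtain S where "finite S" "S \<subseteq> carrier M" "gen_submodule R M S = carrier M"
    using assms by (auto simp: fin_gen_def)
  thus ?thesis unfolding fin_gen_def
    by (intro exI[of _ "e ` S"]) (auto simp: gen_submodule_image)
qed

text \<open>A retract of a retract of a free module is again one: \<open>f\<close> is restricted to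
  the image, and \<open>e \<circ> g\<close> inverts it there because \<open>e\<close> fixes its
  image.\<close>

lemma projective_im:
  assumes "\<And>x. x \<in> carrier M \<Longrightarrow> e (e x) = e x" "projective R M"
  shows "projective R im"
proof -
  obtain I :: "'b set" and f g where fg: "f \<in> module_hom R M (free_module R I)"
    "g \<in> module_hom R (free_module R I) M" "\<forall>x\<in>carrier M. g (f x) = x"
    using assms(2) by (auto simp: projective_def)
  have "f \<in> module_hom R im (free_module R I)"
    using fg(1) closed by (auto simp: module_hom_def)
  moreover have "e \<circ> g \<in> module_hom R (free_module R I) im"
    using fg(2) by (auto simp: module_hom_def Pi_iff add smult)
  ultimately show ?thesis
    unfolding projective_def using fg(3) assms(1) closed
    by (intro exI[of _ I] exI[of _ f] exI[of _ "e \<circ> g"]) auto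
qed

end

lemma pair_module_im:
  assumes "pair_module (A, B) (V, W)" "A \<subseteq> carrier B" "e \<in> pair_hom (A, B) (V, W) (V, W)"
    and "\<And>x. x \<in> carrier W \<Longrightarrow> e (e x) = e x"
  shows "pair_module (A, B) (e ` V, W\<lparr>carrier := e ` carrier W\<rparr>)"
proof -
  have W: "module B W" "fin_gen B W" "projective B W" "submodule V (B\<lparr>carrier := A\<rparr>) W"
    "gen_submodule B W V = carrier W" and e: "e \<in> module_hom B W W"
    using assms by (auto simp: pair_module_def pair_hom_def)
  interpret module_endomorphism B W e
    using W(1) e by (simp add: module_endomorphism_def module_endomorphism_axioms_def)
  have V: "V \<subseteq> carrier W"
    using subgroup.subset[OF submodule.axioms(1)[OF W(4)]] by simp
  have "submodule (e ` V) (B\<lparr>carrier := A\<rparr>) im"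
    using V submodule_image[OF W(4) assms(2)] by (auto simp: submodule_im_iff)
  thus ?thesis
    using W V assms(4) module_im fin_gen_im projective_im gen_submodule_image
    by (simp add: pair_module_def)
qed

text \<open>An idempotent \<open>e\<close> preserving \<open>V\<close> and its complement
  \<open>1 - e\<close> decompose \<open>W\<close> and \<open>V\<close> simultaneously into their
  images; indecomposability forces one of the images to vanish.\<close>

lemma pair_indecomposable_idempotent:
  assumes "pair_indecomposable (A, B) (V, W)" "A \<subseteq> carrier B"
    and "e \<in> pair_hom (A, B) (V, W) (V, W)"
    and idem: "\<And>x. x \<in> carrier W \<Longrightarrow> e (e x) = e x"
  shows "(\<forall>x\<in>carrier W. e x = \<zero>\<^bsub>W\<^esub>) \<or> (\<forall>x\<in>carrier W. e x = x)"
proof -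
  have pm: "pair_module (A, B) (V, W)" using assms(1) by (simp add: pair_indecomposable_def)
  hence W: "module B W" "submodule V (B\<lparr>carrier := A\<rparr>) W" and e: "e \<in> module_hom B W W"
    and eV: "e ` V \<subseteq> V"
    using assms by (auto simp: pair_module_def pair_hom_def)
  interpret module_endomorphism B W e
    using W(1) e by (simp add: module_endomorphism_def module_endomorphism_axioms_def)
  interpret V: submodule V "B\<lparr>carrier := A\<rparr>" W by fact
  have V: "x \<in> carrier W" if "x \<in> V" for x using V.subset that by auto
  define f where "f = (\<lambda>x. x \<ominus>\<^bsub>W\<^esub> e x)"
  have f_closed: "f x \<in> carrier W" if "x \<in> carrier W" for x
    using that by (simp add: f_def closed)
  have f_add: "f (x \<oplus>\<^bsub>W\<^esub> y) = f x \<oplus>\<^bsub>W\<^esub> f y" if "x \<in> carrier W" "y \<in> carrier W" for x y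
    using that by (simp add: f_def closed add M.minus_eq M.minus_add M.a_ac)
  have f_smult: "f (r \<odot>\<^bsub>W\<^esub> x) = r \<odot>\<^bsub>W\<^esub> f x" if "r \<in> carrier B" "x \<in> carrier W" for r x
    using that by (simp add: f_def closed smult M.minus_eq smult_r_distr smult_r_minus)
  have ef: "e (f x) = \<zero>\<^bsub>W\<^esub>" if "x \<in> carrier W" for x
    using that by (simp add: f_def closed add minus idem M.minus_eq M.r_neg)
  have f_idem: "f (f x) = f x" if "x \<in> carrier W" for x
  proof -
    have "f (f x) = f x \<ominus>\<^bsub>W\<^esub> e (f x)" by (simp add: f_def)
    thus ?thesis using that by (simp add: ef f_closed M.minus_eq)
  qed
  have fe: "f (e x) = \<zero>\<^bsub>W\<^esub>" if "x \<in> carrier W" for x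
    using that by (simp add: f_def closed idem M.minus_eq M.r_neg)
  have sum: "e x \<oplus>\<^bsub>W\<^esub> f x = x" if "x \<in> carrier W" for x
    using that by (simp add: f_def closed M.minus_eq M.a_lcomm M.r_neg)
  have fV: "f x \<in> V" if "x \<in> V" for x
    using that eV V.m_closed[of x "\<ominus>\<^bsub>W\<^esub> e x"] V.m_inv_closed[of "e x"]
    by (auto simp: f_def M.minus_eq a_inv_def)
  have f: "f \<in> pair_hom (A, B) (V, W) (V, W)"
    by (auto simp: pair_hom_def module_hom_def f_closed f_add f_smult fV)
  define M1 where "M1 = (e ` V, W\<lparr>carrier := e ` carrier W\<rparr>)"
  define M2 where "M2 = (f ` V, W\<lparr>carrier := f ` carrier W\<rparr>)"
  have "pair_module (A, B) M1" "pair_module (A, B) M2"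
    unfolding M1_def M2_def by (intro pair_module_im pm assms f f_idem; assumption)+
  moreover have "pair_isomorphic (A, B) (V, W) (pair_direct_sum M1 M2)"
    unfolding pair_isomorphic_def
  proof (intro bexI)
    \<comment> \<open>The map \<open>?\<psi>\<close> sends \<open>e\<close> V \<times> f
      \<open>V\<close> back into \<open>V\<close> because both \<open>e\<close> and \<open>f\<close>
      preserve \<open>V\<close>.\<close>
    let ?\<phi> = "\<lambda>x. (e x, f x)" and ?\<psi> = "\<lambda>(x, y). x \<oplus>\<^bsub>W\<^esub> y"
    show "?\<phi> \<in> pair_hom (A, B) (V, W) (pair_direct_sum M1 M2)"
      by (auto simp: M1_def M2_def pair_hom_def pair_direct_sum_def direct_sum_def module_hom_def
          add smult f_add f_smult)
    show "?\<psi> \<in> pair_hom (A, B) (pair_direct_sum M1 M2) (V, W)"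
      using eV fV V.m_closed
      by (auto simp: M1_def M2_def pair_hom_def pair_direct_sum_def direct_sum_def module_hom_def
          closed f_closed M.a_ac smult_r_distr image_subset_iff)
    show "(\<forall>x\<in>carrier (snd (V, W)). ?\<psi> (?\<phi> x) = x) \<and>
        (\<forall>y\<in>carrier (snd (pair_direct_sum M1 M2)). ?\<phi> (?\<psi> y) = y)"
      by (auto simp: M1_def M2_def pair_direct_sum_def direct_sum_def sum
          closed f_closed add f_add ef fe idem f_idem)
  qed
  ultimately have "pair_zero M1 \<or> pair_zero M2"
    using assms(1) unfolding pair_indecomposable_def by blast
  thus ?thesis
  proof
    assume "pair_zero M1"
    thus ?thesis by (auto simp: pair_zero_def M1_def)
  next
    assume "pair_zero M2"
    hence "f x = \<zero>\<^bsub>W\<^esub>" if "x \<in> carrier W" for x using that by (auto simp: pair_zero_def M2_def)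
    thus ?thesis using sum closed by (metis M.r_zero)
  qed
qed

section \<open>Linear relations over power series rings\<close>

text \<open>Gaussian elimination, with more unknowns than equations. A pivot that divides its whole
  row makes division unnecessary, and solving for the pivot unknown leaves the others unchanged, so
  a coefficient equal to 1 survives every step.\<close>

lemma fps_linear_system_unit_coefficient:
  fixes a :: "nat \<Rightarrow> 'i \<Rightarrow> 'k::field fps"
  assumes "finite I" "m < card I"
  shows "\<exists>c. (\<exists>i\<in>I. c i = 1) \<and> (\<forall>r<m. (\<Sum>i\<in>I. c i * a r i) = 0)"
  using assms
proof (induction m arbitrary: I a)
  case 0
  then obtain i where "i \<in> I" by fastforce
  thus ?case by (intro exI[of _ "\<lambda>_. 1"]) auto
next
  case (Suc m)
  obtain j q where j: "j \<in> I" and q: "\<And>i. i \<in> I \<Longrightarrow> a m i = q i * a m j"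
  proof (cases "\<forall>i\<in>I. a m i = 0")
    case True
    moreover obtain j where "j \<in> I" using Suc.prems by fastforce
    ultimately show ?thesis using that[of j "\<lambda>_. 0"] by simp
  next
    case False
    \<comment> \<open>\<open>k[[y]]\<close> is a valuation ring: an entry of least order divides its whole row.\<close>
    then obtain j where j: "j \<in> I" "a m j \<noteq> 0"
      "\<And>i. i \<in> I \<Longrightarrow> a m i \<noteq> 0 \<Longrightarrow> subdegree (a m j) \<le> subdegree (a m i)"
      using ex_has_least_nat[of "\<lambda>i. i \<in> I \<and> a m i \<noteq> 0" _ "\<lambda>i. subdegree (a m i)"] by blast
    hence "a m j dvd a m i" if "i \<in> I" for i
      using that by (cases "a m i = 0") (auto simp: fps_dvd_iff)
    hence "a m i = (a m i div a m j) * a m j" if "i \<in> I" for i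
      using that by simp
    thus ?thesis by (rule that[OF j(1)])
  qed
  have "m < card (I - {j})" using Suc.prems j by simp
  \<comment> \<open>Subtracting \<open>q i\<close> times column \<open>j\<close> from column
    \<open>i\<close> clears row \<open>m\<close> outside the pivot; the induction hypothesis solves
    the remaining \<open>m\<close> rows.\<close>
  with Suc.IH[of "I - {j}" "\<lambda>r i. a r i - q i * a r j"] Suc.prems obtain c i
    where c: "i \<in> I - {j}" "c i = 1"
      "\<And>r. r < m \<Longrightarrow> (\<Sum>i\<in>I - {j}. c i * (a r i - q i * a r j)) = 0" by auto
  \<comment> \<open>The pivot coefficient undoes the column operations, turning a solution of the
    reduced system into one of the original system.\<close>
  define d where "d = c(j := - (\<Sum>i\<in>I - {j}. c i * q i))"
  have d: "(\<Sum>i\<in>I. d i * a r i) = (\<Sum>i\<in>I - {j}. c i * (a r i - q i * a r j))" for r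
  proof -
    have "(\<Sum>i\<in>I. d i * a r i) = d j * a r j + (\<Sum>i\<in>I - {j}. d i * a r i)"
      using Suc.prems j by (simp add: sum.remove)
    also have "(\<Sum>i\<in>I - {j}. d i * a r i) = (\<Sum>i\<in>I - {j}. c i * a r i)"
      by (intro sum.cong) (auto simp: d_def)
    also have "d j * a r j = - (\<Sum>i\<in>I - {j}. c i * (q i * a r j))"
      by (simp add: d_def sum_distrib_right mult.assoc)
    finally show ?thesis by (simp add: right_diff_distrib sum_subtractf)
  qed
  have "(\<Sum>i\<in>I - {j}. c i * (a m i - q i * a m j)) = 0"
    using q by (intro sum.neutral) auto
  hence "\<forall>r<Suc m. (\<Sum>i\<in>I. d i * a r i) = 0"
    using c(3) by (simp add: d less_Suc_eq)
  moreover have "d i = 1" using c by (simp add: d_def)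
  ultimately show ?case using c(1) by blast
qed

text \<open>Here \<open>fps_const g\<close> is the series g(y) in k[[x,y]], so its image is g(t^3):
  only index pairs with \<open>i = 0\<close> contribute.\<close>

lemma subst_t_fps_const_nth:
  "fps_nth (subst_t (fps_const g)) m = (if 3 dvd m then fps_nth g (m div 3) else 0)"
proof -
  have "fps_nth (subst_t (fps_const g)) m =
      (\<Sum>p\<in>{(i, j). 7 * i + 3 * j = m}.
        if p = (0, m div 3) then (if 3 dvd m then fps_nth g (m div 3) else 0) else 0)"
    unfolding subst_t_nth by (intro sum.cong refl) (auto split: if_splits)
  also have "\<dots> = (if 3 dvd m then fps_nth g (m div 3) else 0)"
    by (auto simp: sum.delta[OF finite_index73])
  finally show ?thesis .
qed

text \<open>The powers 1, t, t^2 generate k[[t]] over k[[t^3]]: the exponents of \<open>f\<close>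
  are sorted by their residue modulo 3.\<close>

lemma fps_decompose_mod_3:
  "f = (\<Sum>r<3. fps_X ^ r * subst_t (fps_const (Abs_fps (\<lambda>j. fps_nth f (3 * j + r)))))"
proof (rule fps_ext)
  fix m :: nat
  have "fps_nth (fps_X ^ r * subst_t (fps_const (Abs_fps (\<lambda>j. fps_nth f (3 * j + r))))) m =
      (if r = m mod 3 then fps_nth f m else 0)" if "r < 3" for r
  proof -
    \<comment> \<open>The subtraction on naturals is meaningful only for \<open>r \<le> m\<close>;
      for \<open>m < r\<close> the coefficient is 0 and \<open>r\<close> differs from
      \<open>m mod 3\<close>.\<close>
    have "3 dvd m - r \<longleftrightarrow> r = m mod 3" "r = m mod 3 \<Longrightarrow> 3 * ((m - r) div 3) + r = m" if "r \<le> m"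
      using that \<open>r < 3\<close> by presburger+
    moreover have "r \<noteq> m mod 3" if "m < r" using that \<open>r < 3\<close> by presburger
    ultimately show ?thesis
      by (auto simp: fps_X_power_mult_nth subst_t_fps_const_nth)
  qed
  hence "(\<Sum>r<3. fps_nth (fps_X ^ r * subst_t (fps_const (Abs_fps (\<lambda>j. fps_nth f (3 * j + r))))) m) =
      (\<Sum>r<3. if r = m mod 3 then fps_nth f m else 0)"
    by (intro sum.cong) auto
  thus "fps_nth f m = fps_nth (\<Sum>r<3. fps_X ^ r *
      subst_t (fps_const (Abs_fps (\<lambda>j. fps_nth f (3 * j + r))))) m"
    by (simp add: fps_sum_nth)
qed

lemma subst_t_0: "subst_t 0 = 0"
  using subst_t_diff[of 0 0] by simp

text \<open>Expanding each \<open>f i\<close> in 1, t, t^2 over k[[t^3]] reduces the relation to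
  three linear equations over k[[y]] in more than three unknowns.\<close>

lemma relation_over_fps_in_cube:
  fixes f :: "'i \<Rightarrow> 'k::field fps"
  assumes "finite I" "3 < card I"
  shows "\<exists>c. (\<exists>i\<in>I. c i = 1) \<and> (\<Sum>i\<in>I. subst_t (fps_const (c i)) * f i) = 0"
proof -
  define a where "a = (\<lambda>r i. Abs_fps (\<lambda>j. fps_nth (f i) (3 * j + r)))"
  obtain c where c: "\<exists>i\<in>I. c i = 1" "\<And>r. r < 3 \<Longrightarrow> (\<Sum>i\<in>I. c i * a r i) = 0"
    using fps_linear_system_unit_coefficient[OF assms, of a] by blast
  have const_sum: "subst_t (fps_const (sum h I)) = (\<Sum>i\<in>I. subst_t (fps_const (h i)))"
    for h :: "'i \<Rightarrow> 'k fps"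
    using assms(1) by (induction rule: finite_induct)
      (auto simp: subst_t_add subst_t_0 simp flip: fps_const_add)
  have "(\<Sum>i\<in>I. subst_t (fps_const (c i)) * f i) =
      (\<Sum>i\<in>I. \<Sum>r<3. fps_X ^ r * subst_t (fps_const (c i * a r i)))"
  proof (intro sum.cong refl)
    fix i
    have "subst_t (fps_const (c i)) * f i =
        subst_t (fps_const (c i)) * (\<Sum>r<3. fps_X ^ r * subst_t (fps_const (a r i)))"
      unfolding a_def using fps_decompose_mod_3[of "f i"] by simp
    thus "subst_t (fps_const (c i)) * f i =
        (\<Sum>r<3. fps_X ^ r * subst_t (fps_const (c i * a r i)))"
      by (simp add: sum_distrib_left mult_ac subst_t_mult flip: fps_const_mult)
  qed
  also have "\<dots> = (\<Sum>r<3. fps_X ^ r * subst_t (fps_const (\<Sum>i\<in>I. c i * a r i)))"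
    by (subst sum.swap) (simp add: const_sum sum_distrib_left)
  also have "\<dots> = 0" using c(2) by (simp add: subst_t_0)
  finally show ?thesis using c(1) by blast
qed

section \<open>Computing in \<open>R_art\<close> and \<open>W_module\<close> with power series
  representatives\<close>

definition R_art_coset :: "'k::field fps \<times> 'k fps \<Rightarrow> ('k fps \<times> 'k fps) set" where
  "R_art_coset p = conductor R_bar (R_embed ` carrier R_ring) +>\<^bsub>R_bar\<^esub> p"

definition pow_coset :: "nat \<Rightarrow> 'k::field fps \<Rightarrow> 'k fps set" where
  "pow_coset N f = PIdl\<^bsub>pow1\<^esub> (fps_X ^ N) +>\<^bsub>pow1\<^esub> f"

text \<open>Representatives are total functions on the naturals; their values from \<open>n\<close>
  on do not affect the element.\<close>

definition W_elem :: "nat \<Rightarrow> 'k::field fps \<Rightarrow> (nat \<Rightarrow> 'k fps) \<Rightarrow> 'k fps set \<times> (nat \<Rightarrow> 'k fps set)"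
  where "W_elem n f g = (pow_coset 19 f, \<lambda>i\<in>{..<n}. pow_coset 7 (g i))"

lemma fst_R_art: "fst R_art = range (\<lambda>F. R_art_coset (normalization F))"
  by (auto simp: R_art_def artinian_pair_of_def R_embed_image R_art_coset_def)

lemma carrier_snd_R_art: "carrier (snd R_art) = range R_art_coset"
  by (simp add: carrier_R_art R_art_coset_def[abs_def])

lemma fst_R_art_subset: "fst R_art \<subseteq> carrier (snd R_art)"
  by (auto simp: fst_R_art carrier_snd_R_art)

lemma coset_images:
  "fst ` R_art_coset p = pow_coset 19 (fst p)" "snd ` R_art_coset p = pow_coset 7 (snd p)"
  using fst_snd_coset[of "fst p" "snd p"]
  by (simp_all only: R_art_coset_def pow_coset_def prod.collapse)

lemma pow_coset_eq_iff: "pow_coset N f = pow_coset N f' \<longleftrightarrow> fps_X ^ N dvd f - f'"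
proof
  assume "pow_coset N f = pow_coset N f'"
  moreover have "f \<in> pow_coset N f" unfolding pow_coset_def mem_PIdl_coset by simp
  ultimately show "fps_X ^ N dvd f - f'" by (simp only: pow_coset_def mem_PIdl_coset)
next
  assume "fps_X ^ N dvd f - f'"
  hence "fps_X ^ N dvd u - f \<longleftrightarrow> fps_X ^ N dvd u - f'" for u
    using dvd_add_left_iff[of "fps_X ^ N" "f - f'" "u - f"] by (simp add: algebra_simps)
  thus "pow_coset N f = pow_coset N f'"
    unfolding pow_coset_def by (intro Set.set_eqI) (simp only: mem_PIdl_coset)
qed

text \<open>The quotient enters through an equation for \<open>Q\<close>, so that the definitions of
  \<open>B1\<close> and \<open>B2\<close> can be plugged in directly.\<close>

lemma pow_coset_ops:
  fixes f f' :: "'k::field fps"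
  assumes "Q = pow1 Quot (PIdl\<^bsub>pow1\<^esub> (fps_X ^ N :: 'k fps))"
  shows "carrier Q = range (pow_coset N)"
    "pow_coset N f \<otimes>\<^bsub>Q\<^esub> pow_coset N f' = pow_coset N (f * f')"
    "pow_coset N f \<oplus>\<^bsub>Q\<^esub> pow_coset N f' = pow_coset N (f + f')"
    "\<zero>\<^bsub>Q\<^esub> = pow_coset N 0"
proof -
  have h: "pow_coset N \<in> ring_hom pow1 Q"
    unfolding assms pow_coset_def[abs_def] by (rule ideal.rcos_ring_hom[OF PIdl_pow1_ideal])
  show "pow_coset N f \<otimes>\<^bsub>Q\<^esub> pow_coset N f' = pow_coset N (f * f')"
    "pow_coset N f \<oplus>\<^bsub>Q\<^esub> pow_coset N f' = pow_coset N (f + f')"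
    using ring_hom_mult[OF h, of f f'] ring_hom_add[OF h, of f f'] by simp_all
  show "carrier Q = range (pow_coset N)"
    by (auto simp: assms FactRing_def A_RCOSETS_def' pow_coset_def)
  show "\<zero>\<^bsub>Q\<^esub> = pow_coset N 0"
    by (auto simp: assms FactRing_def pow_coset_def a_r_coset_def')
qed

lemmas B1_ops = pow_coset_ops[OF B1_def]
lemmas B2_ops = pow_coset_ops[OF B2_def]

lemma W_elem_cases:
  assumes "w \<in> carrier (W_module n)"
  obtains f g where "w = W_elem n f g"
proof -
  obtain p q where w: "w = (p, q)" "p \<in> carrier B1" "q \<in> {..<n} \<rightarrow>\<^sub>E carrier B2"
    using assms by (auto simp: W_module_def direct_sum_def restrict_scalars_def regular_module_def
        free_module_def)
  obtain f where f: "p = pow_coset 19 f" using w(2) by (auto simp: B1_ops)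
  have "\<forall>i\<in>{..<n}. \<exists>h. q i = pow_coset 7 h" using w(3) by (auto simp: B2_ops PiE_iff)
  then obtain g where "\<And>i. i < n \<Longrightarrow> q i = pow_coset 7 (g i)" by (metis lessThan_iff)
  hence "q = (\<lambda>i\<in>{..<n}. pow_coset 7 (g i))"
    using w(3) by (auto simp: PiE_iff extensional_def fun_eq_iff)
  thus ?thesis using that w(1) f by (simp add: W_elem_def)
qed

lemma W_module_ops:
  "W_elem n f g \<in> carrier (W_module n)"
  "\<zero>\<^bsub>W_module n\<^esub> = W_elem n 0 (\<lambda>_. 0)"
  "W_elem n f g \<oplus>\<^bsub>W_module n\<^esub> W_elem n f' g' = W_elem n (f + f') (\<lambda>i. g i + g' i)"
  "R_art_coset (a, b) \<odot>\<^bsub>W_module n\<^esub> W_elem n f g = W_elem n (a * f) (\<lambda>i. b * g i)"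
  by (auto simp: W_module_def direct_sum_def restrict_scalars_def regular_module_def
        free_module_def W_elem_def B1_ops B2_ops coset_images fun_eq_iff)

lemma W_module_minus: "\<ominus>\<^bsub>W_module n\<^esub> W_elem n f g = W_elem n (- f) (\<lambda>i. - g i)"
proof -
  interpret W: module "snd R_art" "W_module n" by (rule W_module_module)
  show ?thesis by (rule W.M.minus_equality) (simp_all add: W_module_ops)
qed

lemma W_elem_eq_iff:
  "W_elem n f g = W_elem n f' g' \<longleftrightarrow>
     fps_X ^ 19 dvd f - f' \<and> (\<forall>i<n. fps_X ^ 7 dvd g i - g' i)"
proof -
  have "(\<lambda>i\<in>{..<n}. pow_coset 7 (g i)) = (\<lambda>i\<in>{..<n}. pow_coset 7 (g' i)) \<longleftrightarrow>
      (\<forall>i<n. pow_coset 7 (g i) = pow_coset 7 (g' i))"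
    by (metis (mono_tags, lifting) lessThan_iff restrict_apply' restrict_ext)
  thus ?thesis by (simp add: W_elem_def pow_coset_eq_iff)
qed

section \<open>Elements of \<open>V\<close> and the idempotent they provide\<close>

locale R_art_module =
  fixes n :: nat and V :: "('k::field fps set \<times> (nat \<Rightarrow> 'k fps set)) set"
  assumes pair_module: "pair_module R_art (V, W_module n)"
begin

lemma V_submodule: "submodule V (snd R_art\<lparr>carrier := fst R_art\<rparr>) (W_module n)"
  and V_generates: "gen_submodule (snd R_art) (W_module n) V = carrier (W_module n)"
  using pair_module by (simp_all add: pair_module_def case_prod_beta)

lemma V_subset: "V \<subseteq> carrier (W_module n)"
  using subgroup.subset[OF submodule.axioms(1)[OF V_submodule]] by simp

lemma V_zero: "W_elem n 0 (\<lambda>_. 0) \<in> V"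
  using subgroup.one_closed[OF submodule.axioms(1)[OF V_submodule]] by (simp add: W_module_ops)

lemma V_add:
  assumes "W_elem n f g \<in> V" "W_elem n f' g' \<in> V"
  shows "W_elem n (f + f') (\<lambda>i. g i + g' i) \<in> V"
  using subgroup.m_closed[OF submodule.axioms(1)[OF V_submodule] assms] by (simp add: W_module_ops)

text \<open>The scalar is the class of b(y) in \<open>A\<close>, which acts as b(t^3) on the first
  component and as b(y) on the second.\<close>

lemma V_smult:
  assumes "W_elem n f g \<in> V"
  shows "W_elem n (subst_t (fps_const b) * f) (\<lambda>i. b * g i) \<in> V"
proof -
  have "R_art_coset (normalization (fps_const b)) \<odot>\<^bsub>W_module n\<^esub> W_elem n f g \<in> V"
    by (rule submodule.smult_closed[OF V_submodule _ assms]) (auto simp: fst_R_art)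
  thus ?thesis by (simp add: normalization_def W_module_ops)
qed

lemma V_minus:
  assumes "W_elem n f g \<in> V"
  shows "W_elem n (- f) (\<lambda>i. - g i) \<in> V"
  using subgroup.m_inv_closed[OF submodule.axioms(1)[OF V_submodule] assms]
  by (simp add: W_module_minus flip: a_inv_def)

lemma V_snd_surj: "\<exists>f. W_elem n f g \<in> V"
proof -
  interpret W: module "snd R_art" "W_module n" by (rule W_module_module)
  \<comment> \<open>This is the full preimage in \<open>W\<close> of the projection of
    \<open>V\<close>: the first component is arbitrary. Being a submodule over \<open>B\<close> that
    contains \<open>V\<close>, it is all of \<open>W\<close>.\<close>
  define N where "N = {w. \<exists>f' f g. w = W_elem n f' g \<and> W_elem n f g \<in> V}"
  have "submodule N (snd R_art) (W_module n)"
  proof (rule W.submoduleI)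
    show "N \<subseteq> carrier (W_module n)" by (auto simp: N_def W_module_ops)
    show "\<zero>\<^bsub>W_module n\<^esub> \<in> N" using V_zero by (auto simp: N_def W_module_ops)
    show "\<ominus>\<^bsub>W_module n\<^esub> w \<in> N" if "w \<in> N" for w
      using that V_minus by (fastforce simp: N_def W_module_minus)
    show "w \<oplus>\<^bsub>W_module n\<^esub> w' \<in> N" if "w \<in> N" "w' \<in> N" for w w'
      using that V_add by (fastforce simp: N_def W_module_ops)
    show "r \<odot>\<^bsub>W_module n\<^esub> w \<in> N" if "r \<in> carrier (snd R_art)" "w \<in> N" for r w
      using that V_smult by (fastforce simp: N_def W_module_ops carrier_snd_R_art)
  qed
  moreover have "V \<subseteq> N"
  proof
    fix w assume "w \<in> V"
    moreover obtain f g where "w = W_elem n f g"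
      using \<open>w \<in> V\<close> V_subset by (blast elim: W_elem_cases)
    ultimately show "w \<in> N" unfolding N_def by blast
  qed
  ultimately have "carrier (W_module n) \<subseteq> N"
    using gen_submodule_least V_generates by metis
  hence "W_elem n 0 g \<in> N" using W_module_ops(1) by blast
  then obtain f' f g' where "W_elem n 0 g = W_elem n f' g'" "W_elem n f g' \<in> V"
    by (auto simp: N_def)
  moreover from this have "W_elem n f g = W_elem n f g'" by (simp add: W_elem_def)
  ultimately show ?thesis by metis
qed

lemma V_unimodular:
  assumes "3 < n"
  obtains c i where "i < n" "c i = 1" "W_elem n 0 c \<in> V"
proof -
  define f where "f = (\<lambda>i. SOME h. W_elem n h (\<lambda>j. if j = i then 1 else 0) \<in> V)"
  have f: "W_elem n (f i) (\<lambda>j. if j = i then 1 else 0) \<in> V" for i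
    unfolding f_def by (rule someI_ex[OF V_snd_surj])
  obtain c i where c: "i < n" "c i = 1" "(\<Sum>i<n. subst_t (fps_const (c i)) * f i) = 0"
    using relation_over_fps_in_cube[of "{..<n}" f] assms by auto
  \<comment> \<open>These are the partial sums of the lifted basis vectors scaled by c_i(y); at
    \<open>m = n\<close> the relation kills the first component.\<close>
  have "W_elem n (\<Sum>i<m. subst_t (fps_const (c i)) * f i) (\<lambda>j. if j < m then c j else 0) \<in> V" for m
  proof (induction m)
    case 0
    thus ?case using V_zero by simp
  next
    case (Suc m)
    have "(\<lambda>j. (if j < m then c j else 0) + c m * (if j = m then 1 else 0)) =
        (\<lambda>j. if j < Suc m then c j else 0)" by (auto simp: fun_eq_iff less_Suc_eq)
    thus ?case using V_add[OF Suc V_smult[OF f[of m], of "c m"]] by simp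
  qed
  from this[of n] have "W_elem n 0 (\<lambda>j. if j < n then c j else 0) \<in> V" by (simp add: c(3))
  moreover have "W_elem n 0 (\<lambda>j. if j < n then c j else 0) = W_elem n 0 c"
    by (simp add: W_elem_eq_iff)
  ultimately have "W_elem n 0 c \<in> V" by simp
  thus ?thesis by (rule that[of i c, OF c(1,2)])
qed

end

theorem proposition4p2:
  fixes n :: nat
  assumes "n \<ge> 4"
  shows "\<not> (\<exists>V :: ('k::field fps set \<times> (nat \<Rightarrow> 'k fps set)) set.
              pair_indecomposable R_art (V, W_module n))"
proof
  assume "\<exists>V :: ('k fps set \<times> (nat \<Rightarrow> 'k fps set)) set.
    pair_indecomposable R_art (V, W_module n)"
  then obtain V :: "('k fps set \<times> (nat \<Rightarrow> 'k fps set)) set"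
    where ind: "pair_indecomposable R_art (V, W_module n)" ..
  interpret R_art_module n V
    using ind by unfold_locales (simp add: pair_indecomposable_def)
  have "3 < n" using assms by simp
  then obtain c i where c: "i < n" "c i = 1" "W_elem n 0 c \<in> V" by (rule V_unimodular)
  \<comment> \<open>Working with cosets rather than representatives makes well-definedness
    automatic. Idempotence will follow from \<open>c i = 1\<close>.\<close>
  define e :: "'k fps set \<times> (nat \<Rightarrow> 'k fps set) \<Rightarrow> 'k fps set \<times> (nat \<Rightarrow> 'k fps set)"
    where "e = (\<lambda>(p, q). (pow_coset 19 0, \<lambda>j\<in>{..<n}. q i \<otimes>\<^bsub>B2\<^esub> pow_coset 7 (c j)))"
  have e: "e (W_elem n f g) = W_elem n 0 (\<lambda>j. g i * c j)" for f g
    using c(1) by (simp add: e_def W_elem_def B2_ops)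
  have "e \<in> module_hom (snd R_art) (W_module n) (W_module n)"
    unfolding module_hom_def
  proof (intro CollectI conjI ballI Pi_I)
    fix w w' :: "'k fps set \<times> (nat \<Rightarrow> 'k fps set)"
    assume "w \<in> carrier (W_module n)" "w' \<in> carrier (W_module n)"
    then obtain f g f' g' where "w = W_elem n f g" "w' = W_elem n f' g'" by (metis W_elem_cases)
    thus "e (w \<oplus>\<^bsub>W_module n\<^esub> w') = e w \<oplus>\<^bsub>W_module n\<^esub> e w'"
      by (simp add: e W_module_ops distrib_right)
  next
    fix w :: "'k fps set \<times> (nat \<Rightarrow> 'k fps set)" and r :: "('k fps \<times> 'k fps) set"
    assume "w \<in> carrier (W_module n)" and r: "r \<in> carrier (snd R_art)"
    then obtain f g where "w = W_elem n f g" by (metis W_elem_cases)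
    thus "e (r \<odot>\<^bsub>W_module n\<^esub> w) = r \<odot>\<^bsub>W_module n\<^esub> e w"
      using r by (auto simp: e W_module_ops carrier_snd_R_art mult.assoc)
  next
    fix w :: "'k fps set \<times> (nat \<Rightarrow> 'k fps set)"
    assume "w \<in> carrier (W_module n)"
    then obtain f g where "w = W_elem n f g" by (metis W_elem_cases)
    thus "e w \<in> carrier (W_module n)" by (simp add: e W_module_ops)
  qed
  moreover have "e ` V \<subseteq> V"
  proof (rule image_subsetI)
    fix w assume "w \<in> V"
    then obtain f g where "w = W_elem n f g" using V_subset by (blast elim: W_elem_cases)
    \<comment> \<open>The image of \<open>w\<close> is the multiple of (0, c) by the class of g_i(y)
      in \<open>A\<close>; its first component g_i(t^3) * 0 vanishes.\<close>
    thus "e w \<in> V" using V_smult[OF c(3), of "g i"] by (simp add: e)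
  qed
  ultimately have hom: "e \<in> pair_hom (fst R_art, snd R_art) (V, W_module n) (V, W_module n)"
    by (simp add: pair_hom_def case_prod_beta)
  have idem: "e (e w) = e w" if "w \<in> carrier (W_module n)" for w
    using that by (rule W_elem_cases) (simp add: e c(2))
  have "(\<forall>x\<in>carrier (W_module n). e x = \<zero>\<^bsub>W_module n\<^esub>) \<or> (\<forall>x\<in>carrier (W_module n). e x = x)"
    by (rule pair_indecomposable_idempotent[OF _ fst_R_art_subset hom idem]) (simp_all add: ind)
  \<comment> \<open>The element (0, c) is fixed by \<open>e\<close> and nonzero, since its
    coordinate \<open>c i = 1\<close> is not divisible by y^7.\<close>
  moreover have "e (W_elem n 0 c) \<noteq> \<zero>\<^bsub>W_module n\<^esub>"
  proof -
    have "\<not> fps_X ^ 7 dvd c i - 0" by (simp add: c(2) is_unit_power_iff)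
    thus ?thesis using c(1,2) by (auto simp: e W_module_ops W_elem_eq_iff)
  qed
  \<comment> \<open>The element (1, 0) is sent to 0 but is nonzero, so \<open>e\<close> is not the
    identity either.\<close>
  moreover have "e (W_elem n 1 (\<lambda>_. 0)) \<noteq> W_elem n 1 (\<lambda>_. 0)"
    by (simp add: e W_elem_eq_iff is_unit_power_iff)
  ultimately show False using W_module_ops(1) by blast
qed

end
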